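(* Let $\kappa,a,\beta>0$, and let $\mathbf H$ be the classical lattice physical Hamiltonian defined in the context with $C_v:=C_{0,v}$ (Euclidean Hamiltonian). Consider, for functions $\theta(\tau)\in\mathbb R$, $p(\tau)>0$, the cosmological evolution equations $$\frac{d\theta}{d\tau}=-\frac{\kappa}{a^2}\frac{\partial \mathbf H}{\partial\,\delta p_\parallel(e_I(v))}\Big|_{\delta\theta=\delta p=0},\qquad \frac{dp}{d\tau}=\frac{\kappa}{a^2}\frac{\partial \mathbf H}{\partial\,\delta \theta_\parallel(e_I(v))}\Big|_{\delta\theta=\delta p=0}\qquad\text{for all } I, v,\tag{E}$$ and the constraint equations $$\frac{\partial \mathbf H}{\partial\,\delta p^b_\bot(e_I(v))}\Big|_{\delta\theta=\delta p=0}=0,\qquad \frac{\partial \mathbf H}{\partial\,\delta \theta^b_\bot(e_I(v))}\Big|_{\delta\theta=\delta p=0}=0\qquad\text{for all } I,v \text{ and } b\neq I.\tag{C}$$ (i) For $\mathbf H=\mathbf H_{dust}$, in either the Brown-Kuchař ($\alpha=1$) or the Gaussian ($\alpha=0$) dust model, (E) is equivalent to $$\frac{d\theta}{d\tau}=-\frac{\partial}{\partial p}\left[\frac{4}{3a}\sqrt{2\beta p}\,\sin^2\theta\right],\qquad \frac{dp}{d\tau}=\frac{\partial}{\partial\theta}\left[\frac{4}{3a}\sqrt{2\beta p}\,\sin^2\theta\right],$$ while (C) is satisfied automatically. (ii) For $\mathbf H=\mathbf H_{scalar}$ (gravity-scalar model), (E) is equivalent to $$\frac{d\theta}{d\tau}=-\frac{\partial}{\partial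 p}\left[\frac{\sqrt{2\kappa}\,\beta p}{3}\sqrt{\sin^2\theta}\right],\qquad \frac{dp}{d\tau}=\frac{\partial}{\partial\theta}\left[\frac{\sqrt{2\kappa}\,\beta p}{3}\sqrt{\sin^2\theta}\right],$$ while (C) is again satisfied automatically.
   Context: Conventions: $\tau^a=\tau_a=-i\sigma^a$ ($\sigma^a$ Pauli matrices, $a=1,2,3$), $\tau_0=1_{2\times2}$; repeated su(2) indices are summed. Lattice: $\gamma$ is the periodic cubic lattice with vertex set $V(\gamma)=(\mathbb Z/L)^3$ (every vertex 6-valent, with six distinct edges), oriented edges $e_I(v)$ from $v$ to $v+\hat I$, $I=1,2,3$. Write $e_{v;I+}=e_I(v)$ and $e_{v;I-}=e_I(v-\hat I)^{-1}$ (both start at $v$). Phase space: each edge $e$ carries $h(e)\in SU(2)$ and $p(e)=(p^a(e))\in\mathbb R^3$, with Poisson brackets $\{h(e),h(e')\}=0$, $\{p^a(e),h(e')\}=\frac{\kappa}{a^2}\delta_{e,e'}\frac{\tau^a}{2}h(e')$, $\{p^a(e),p^b(e')\}=-\frac{\kappa}{a^2}\delta_{e,e'}\epsilon_{abc}p^c(e')$. For reversed edges $h(e^{-1})=h(e)^{-1}$, $p^a(e^{-1})=\frac12\mathrm{Tr}[\tau^a h(e)^{-1}p^b(e)\tau^b h(e)]$. For signs $s,s'=\pm1$ and $I\ne J$, the square-loop holonomy is $h(\alpha_{v;Is,Js'})=h(e_{v;Is})\,h(e_{v+s\hat I;Js'})\,h(e_{v+s'\hat J;Is})^{-1}\,h(e_{v;Js'})^{-1}$.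 Volume: $V_v=|Q_v|^{1/2}$, $Q_v=\left(\frac{\beta a^2}{2}\right)^3\epsilon_{abc}X_1^aX_2^bX_3^c$, $X_I^a=\frac12\left(p^a(e_{v;I+})-p^a(e_{v;I-})\right)$. Constraints, for $\mu=0,1,2,3$ (with $j$ denoting $\mu=1,2,3$): $$C_{\mu,v}=-\frac{8}{3\beta\kappa^2}\sum_{s_1,s_2,s_3=\pm1}\ \sum_{I_1,I_2,I_3}s_1s_2s_3\,\epsilon^{I_1I_2I_3}\,\mathrm{Tr}\Big(\tau_\mu\,h(\alpha_{v;I_1s_1,I_2s_2})\,h(e_{v;I_3s_3})\{h(e_{v;I_3s_3})^{-1},V_v\}\Big).$$ Physical Hamiltonians built from a Hamiltonian constraint $C_v$: $\mathbf H_{dust}=\sum_{v}\big|C_v^2-\frac{\alpha}{4}\sum_{j=1}^3C_{j,v}^2\big|^{1/2}$ with $\alpha=1$ (Brown-Kuchař dust) or $\alpha=0$ (Gaussian dust), and $\mathbf H_{scalar}=\sum_v|V_vC_v|^{1/2}$. Perturbed homogeneous isotropic data: given constants $\theta\in\mathbb R$, $p>0$, $\mathbf H$ is regarded as a function of independent real perturbations by evaluating it at $p^b(e_I(v))=[p+\delta p_\parallel(e_I(v))]\delta^b_I+\delta p_\bot^b(e_I(v))$ and $h(e_I(v))=e^{\theta^b(e_I(v))\tau^b/2}$ with $\theta^b(e_I(v))=[\theta+\delta\theta_\parallel(e_I(v))]\delta^b_I+\delta\theta^b_\bot(e_I(v))$, where $\delta p_\bot^I(e_I(v))=\delta\theta_\bot^I(e_I(v))=0$.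 "$\delta\theta=\delta p=0$" means all perturbations vanish.
   Formalization: Since partial derivatives of H may fail to exist where sin θ = 0, the equivalence of (E) with the reduced equations is stated for trajectories along which all derivatives involved exist (always if sin θ ≠ 0); (C) holds for sin θ ≠ 0, and elsewhere every derivative in (C) that exists is 0. *)

theory Defs
  imports "HOL-Analysis.Analysis" "Berlekamp_Zassenhaus.Finite_Field"
begin

section \<open>Pauli matrices and \<open>SU(2)\<close>\<close>

text \<open>The index type \<open>3\<close> has the elements \<open>1, 2, 3 (= 0)\<close>; it serves for the su(2) indices
  and for the lattice directions.\<close>

type_synonym mat2 = "complex^2^2"

definition pauli :: "3 \<Rightarrow> mat2" where
  "pauli a =
     (if a = 1 then vector [vector [0, 1], vector [1, 0]]
      else if a = 2 then vector [vector [0, - \<i>], vector [\<i>, 0]]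
      else vector [vector [1, 0], vector [0, - 1]])"

definition tau :: "3 \<Rightarrow> mat2" where
  "tau a = (\<chi> i j. - \<i> * pauli a $ i $ j)"

definition levi_civita :: "3 \<Rightarrow> 3 \<Rightarrow> 3 \<Rightarrow> real" where
  "levi_civita i j k =
     (if (i, j, k) \<in> {(1, 2, 3), (2, 3, 1), (3, 1, 2)} then 1
      else if (i, j, k) \<in> {(1, 3, 2), (3, 2, 1), (2, 1, 3)} then - 1
      else 0)"

text \<open>The product \<open>*\<close> on vectors is componentwise, so powers and the exponential series are
  formed with the matrix product \<open>**\<close>.\<close>

definition mexp :: "mat2 \<Rightarrow> mat2" where
  "mexp A = (\<Sum>n. (((**) A ^^ n) (mat 1)) /\<^sub>R fact n)"

definition su2_exp :: "real^3 \<Rightarrow> mat2" where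
  "su2_exp x = mexp (\<Sum>b\<in>UNIV. (x $ b / 2) *\<^sub>R tau b)"

lemma su2_exp_axis: "su2_exp (axis b t) = cos (t / 2) *\<^sub>R mat 1 + sin (t / 2) *\<^sub>R tau b"
proof -
  define s where "s = t / 2"
  have arg: "(\<Sum>c\<in>UNIV. (axis b t $ c / 2) *\<^sub>R tau c) = s *\<^sub>R tau b"
  proof -
    have "(\<Sum>c\<in>UNIV. (axis b t $ c / 2) *\<^sub>R tau c) = (\<Sum>c\<in>UNIV. if c = b then s *\<^sub>R tau b else 0)"
      by (rule sum.cong) (auto simp: axis_def s_def)
    then show ?thesis by simp
  qed
  have sq: "tau b ** tau b = - mat 1"
    using exhaust_3[of b]
    by (auto simp: vec_eq_iff matrix_matrix_mult_def forall_2 sum_2 tau_def pauli_def mat_def)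
  have mult: "(s *\<^sub>R tau b) ** (x *\<^sub>R mat 1 + y *\<^sub>R tau b)
      = (s * x) *\<^sub>R tau b + (s * y) *\<^sub>R (tau b ** tau b)" for x y
    by (simp add: vec_eq_iff matrix_matrix_mult_def forall_2 sum_2 mat_def)
      (simp add: scaleR_conv_of_real algebra_simps)
  have pow: "(((**) (s *\<^sub>R tau b) ^^ n) (mat 1)) /\<^sub>R fact n
      = (cos_coeff n * s ^ n) *\<^sub>R mat 1 + (sin_coeff n * s ^ n) *\<^sub>R tau b" for n
  proof (induction n)
    case 0
    then show ?case by simp
  next
    case (Suc n)
    have "((**) (s *\<^sub>R tau b) ^^ n) (mat 1)
      = fact n *\<^sub>R ((cos_coeff n * s ^ n) *\<^sub>R mat 1 + (sin_coeff n * s ^ n) *\<^sub>R tau b)"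
      using arg_cong[OF Suc, of "\<lambda>z. (fact n :: real) *\<^sub>R z"] by simp
    then have *: "((**) (s *\<^sub>R tau b) ^^ n) (mat 1)
      = (fact n * (cos_coeff n * s ^ n)) *\<^sub>R mat 1 + (fact n * (sin_coeff n * s ^ n)) *\<^sub>R tau b"
      by (simp add: scaleR_add_right)
    have c: "inverse (fact (Suc n)) * (s * (fact n * (cos_coeff n * s ^ n))) = sin_coeff (Suc n) * s ^ Suc n"
      and d: "inverse (fact (Suc n)) * (s * (fact n * (sin_coeff n * s ^ n))) = - (cos_coeff (Suc n) * s ^ Suc n)"
      by (simp_all add: cos_coeff_Suc sin_coeff_Suc field_simps del: of_nat_Suc)
    have "(((**) (s *\<^sub>R tau b) ^^ Suc n) (mat 1)) /\<^sub>R fact (Suc n)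
      = (inverse (fact (Suc n)) * (s * (fact n * (cos_coeff n * s ^ n)))) *\<^sub>R tau b
      - (inverse (fact (Suc n)) * (s * (fact n * (sin_coeff n * s ^ n)))) *\<^sub>R mat 1"
      unfolding funpow.simps o_apply * mult sq
      by (simp add: scaleR_add_right scaleR_diff_right del: fact_Suc)
    then show ?case unfolding c d by simp
  qed
  have "(\<lambda>n. (cos_coeff n * s ^ n) *\<^sub>R (mat 1 :: mat2) + (sin_coeff n * s ^ n) *\<^sub>R tau b)
      sums (cos s *\<^sub>R mat 1 + sin s *\<^sub>R tau b)"
    using cos_converges[of s] sin_converges[of s]
    by (intro sums_add sums_scaleR_left) auto
  then show ?thesis
    unfolding su2_exp_def mexp_def arg pow s_def[symmetric] by (rule sums_unique[symmetric])
qed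


section \<open>The periodic cubic lattice and its phase space\<close>

text \<open>The lattice size is \<open>L = CARD('l)\<close>. The class \<open>nontriv\<close> says \<open>CARD('l) > 1\<close>; for \<open>L = 1\<close>
  the two edges \<open>e\<^sub>I(v)\<close> and \<open>e\<^sub>I(v - I)\<close> would coincide and a vertex would not have six
  distinct edges. The edge \<open>e\<^sub>I(v)\<close> is the pair \<open>(v, I)\<close>. A phase space point is a pair
  \<open>(h, p)\<close>; it is meant that all \<open>h e\<close> lie in \<open>SU(2)\<close>, and only such points are ever used
  below.\<close>

type_synonym 'l vertex = "'l mod_ring ^ 3"
type_synonym 'l edge = "'l vertex \<times> 3"
type_synonym 'l state = "('l edge \<Rightarrow> mat2) \<times> ('l edge \<Rightarrow> real^3)"

definition shift :: "'l::nontriv vertex \<Rightarrow> 3 \<Rightarrow> int \<Rightarrow> 'l vertex" where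
  "shift v I s = v + axis I (of_int s)"

text \<open>Holonomy and flux of \<open>e\<^sub>v\<^sub>;\<^sub>I\<^sub>s\<close>, \<open>s = \<plusminus>1\<close>. The traces of the reversed fluxes are real.\<close>

definition hol :: "'l::nontriv state \<Rightarrow> 'l vertex \<Rightarrow> 3 \<Rightarrow> int \<Rightarrow> mat2" where
  "hol x v I s = (if s = 1 then fst x (v, I) else matrix_inv (fst x (shift v I (- 1), I)))"

definition rev_flux :: "mat2 \<Rightarrow> real^3 \<Rightarrow> real^3" where
  "rev_flux h p = (\<chi> a. 1 / 2 *
     Re (trace (tau a ** matrix_inv h ** (\<Sum>b\<in>UNIV. p $ b *\<^sub>R tau b) ** h)))"

definition flux :: "'l::nontriv state \<Rightarrow> 'l vertex \<Rightarrow> 3 \<Rightarrow> int \<Rightarrow> real^3" where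
  "flux x v I s =
     (if s = 1 then snd x (v, I)
      else rev_flux (fst x (shift v I (- 1), I)) (snd x (shift v I (- 1), I)))"

definition loop_hol :: "'l::nontriv state \<Rightarrow> 'l vertex \<Rightarrow> 3 \<Rightarrow> int \<Rightarrow> 3 \<Rightarrow> int \<Rightarrow> mat2" where
  "loop_hol x v I s J s' =
     hol x v I s ** hol x (shift v I s) J s'
     ** matrix_inv (hol x (shift v J s') I s) ** matrix_inv (hol x v J s')"

text \<open>The Poisson bracket is the biderivation determined by
  \<open>{h(e), h(e')} = 0\<close>, \<open>{p\<^sup>a(e), h(e')} = \<kappa>/a\<^sup>2 \<delta> \<tau>\<^sup>a/2 h(e')\<close> and
  \<open>{p\<^sup>a(e), p\<^sup>b(e')} = - \<kappa>/a\<^sup>2 \<delta> \<epsilon>\<^sub>a\<^sub>b\<^sub>c p\<^sup>c(e')\<close>. The second relation says that \<open>p\<^sup>a(e)\<close> acts on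
  functions of \<open>h(e)\<close> through the vector field of the flow \<open>h(e) \<mapsto> exp (t \<tau>\<^sup>a/2) h(e)\<close> on
  \<open>SU(2)\<close>, and \<open>bracket_hol_hol\<close>, \<open>bracket_flux_hol\<close> and \<open>bracket_flux_flux\<close> below confirm
  the three relations.\<close>

definition d_flux :: "'l::nontriv edge \<Rightarrow> 3 \<Rightarrow> ('l state \<Rightarrow> complex) \<Rightarrow> 'l state \<Rightarrow> complex" where
  "d_flux e a f x =
     vector_derivative (\<lambda>t. f (fst x, (snd x)(e := snd x e + axis a t))) (at 0)"

definition d_hol :: "'l::nontriv edge \<Rightarrow> 3 \<Rightarrow> ('l state \<Rightarrow> complex) \<Rightarrow> 'l state \<Rightarrow> complex" where
  "d_hol e a f x =
     vector_derivative (\<lambda>t. f ((fst x)(e := su2_exp (axis a t) ** fst x e), snd x)) (at 0)"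

definition bracket ::
  "real \<Rightarrow> real \<Rightarrow> ('l::nontriv state \<Rightarrow> complex) \<Rightarrow> ('l state \<Rightarrow> complex) \<Rightarrow> 'l state \<Rightarrow> complex"
where
  "bracket \<kappa> a f g x = of_real (\<kappa> / a\<^sup>2) * (\<Sum>e\<in>UNIV.
      (\<Sum>b\<in>UNIV. d_flux e b f x * d_hol e b g x - d_hol e b f x * d_flux e b g x)
    - (\<Sum>b\<in>UNIV. \<Sum>c\<in>UNIV. \<Sum>d\<in>UNIV.
        of_real (levi_civita b c d * snd x e $ d) * d_flux e b f x * d_flux e c g x))"

lemma d_flux_hol: "d_flux e b (\<lambda>y. fst y e' $ i $ j) x = 0"
  by (simp add: d_flux_def)

lemma d_hol_flux: "d_hol e b (\<lambda>y. complex_of_real (snd y e' $ c)) x = 0"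
  by (simp add: d_hol_def)

lemma d_flux_flux:
  "d_flux e b (\<lambda>y. complex_of_real (snd y e' $ c)) x = (if e = e' \<and> b = c then 1 else 0)"
proof -
  have "((\<lambda>t. complex_of_real (((snd x)(e := snd x e + axis b t)) e' $ c))
      has_vector_derivative (if e = e' \<and> b = c then 1 else 0)) (at 0)"
    by (cases "e = e'"; cases "b = c") (auto simp: axis_def intro!: derivative_eq_intros)
  then show ?thesis by (simp add: d_flux_def vector_derivative_at)
qed

lemma d_hol_hol:
  "d_hol e b (\<lambda>y. fst y e' $ i $ j) x = (if e = e' then (tau b ** fst x e') $ i $ j / 2 else 0)"
proof (cases "e = e'")
  case True
  have "((\<lambda>t. (cos (t / 2) *\<^sub>R (fst x e $ i $ j) + sin (t / 2) *\<^sub>R ((tau b ** fst x e) $ i $ j)))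
      has_vector_derivative (tau b ** fst x e) $ i $ j / 2) (at 0)"
    by (auto intro!: derivative_eq_intros simp: scaleR_conv_of_real)
  moreover have "(su2_exp (axis b t) ** fst x e) $ i $ j
      = cos (t / 2) *\<^sub>R (fst x e $ i $ j) + sin (t / 2) *\<^sub>R ((tau b ** fst x e) $ i $ j)" for t
    unfolding su2_exp_axis
    using exhaust_2[of i]
    by (auto simp: matrix_matrix_mult_def sum_2 mat_def)
      (simp_all add: scaleR_conv_of_real algebra_simps)
  ultimately show ?thesis using True by (simp add: d_hol_def vector_derivative_at)
qed (simp add: d_hol_def)

lemma bracket_hol_hol: "bracket \<kappa> a (\<lambda>y. fst y e $ i $ j) (\<lambda>y. fst y e' $ k $ l) x = 0"
  by (simp add: bracket_def d_flux_hol)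

lemma bracket_flux_hol:
  "bracket \<kappa> a (\<lambda>y. complex_of_real (snd y e $ b)) (\<lambda>y. fst y e' $ i $ j) x
     = of_real (\<kappa> / a\<^sup>2) * (if e = e' then (tau b ** fst x e') $ i $ j / 2 else 0)"
proof -
  have "(\<Sum>c\<in>UNIV. (if e'' = e \<and> c = b then 1 else 0) * (if e'' = e' then (tau c ** fst x e') $ i $ j / 2 else 0))
     = (if e'' = e then if e = e' then (tau b ** fst x e') $ i $ j / 2 else 0 else 0)" for e''
    by (auto simp: if_distrib[where f="\<lambda>z. z * _"] cong: if_cong)
  then show ?thesis
    by (simp add: bracket_def d_flux_hol d_hol_flux d_flux_flux d_hol_hol)
qed

lemma bracket_flux_flux:
  "bracket \<kappa> a (\<lambda>y. complex_of_real (snd y e $ b)) (\<lambda>y. complex_of_real (snd y e' $ c)) x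
     = - of_real (\<kappa> / a\<^sup>2) *
       (if e = e' then \<Sum>d\<in>UNIV. of_real (levi_civita b c d * snd x e' $ d) else 0)"
proof -
  have "(\<Sum>b'\<in>UNIV. \<Sum>c'\<in>UNIV. \<Sum>d\<in>UNIV. complex_of_real (levi_civita b' c' d * snd x e'' $ d)
          * (if e'' = e \<and> b' = b then 1 else 0) * (if e'' = e' \<and> c' = c then 1 else 0))
     = (if e'' = e then if e = e' then \<Sum>d\<in>UNIV. of_real (levi_civita b c d * snd x e' $ d) else 0 else 0)"
    for e''
  proof -
    have "(\<Sum>b'\<in>UNIV. \<Sum>c'\<in>UNIV. \<Sum>d\<in>UNIV. complex_of_real (levi_civita b' c' d * snd x e'' $ d)
          * (if e'' = e \<and> b' = b then 1 else 0) * (if e'' = e' \<and> c' = c then 1 else 0))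
      = (\<Sum>b'\<in>UNIV. \<Sum>c'\<in>UNIV. if b' = b then if c' = c then if e'' = e \<and> e'' = e' then
           \<Sum>d\<in>UNIV. complex_of_real (levi_civita b' c' d * snd x e'' $ d) else 0 else 0 else 0)"
      by (intro sum.cong refl) auto
    also have "\<dots> = (\<Sum>b'\<in>UNIV. if b' = b then \<Sum>c'\<in>UNIV. if c' = c then if e'' = e \<and> e'' = e' then
           \<Sum>d\<in>UNIV. complex_of_real (levi_civita b' c' d * snd x e'' $ d) else 0 else 0 else 0)"
      by (intro sum.cong refl) auto
    finally show ?thesis by auto
  qed
  then show ?thesis
    by (simp add: bracket_def d_hol_flux d_flux_flux sum_negf)
qed

definition mat_bracket ::
  "real \<Rightarrow> real \<Rightarrow> ('l::nontriv state \<Rightarrow> mat2) \<Rightarrow> ('l state \<Rightarrow> complex) \<Rightarrow> 'l state \<Rightarrow> mat2"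
where
  "mat_bracket \<kappa> a F g x = (\<chi> i j. bracket \<kappa> a (\<lambda>y. F y $ i $ j) g x)"


section \<open>Volume, constraints and physical Hamiltonians\<close>

definition X_flux :: "'l::nontriv state \<Rightarrow> 'l vertex \<Rightarrow> 3 \<Rightarrow> real^3" where
  "X_flux x v I = (1 / 2) *\<^sub>R (flux x v I 1 - flux x v I (- 1))"

definition Q_vol :: "real \<Rightarrow> real \<Rightarrow> 'l::nontriv vertex \<Rightarrow> 'l state \<Rightarrow> real" where
  "Q_vol a \<beta> v x = (\<beta> * a\<^sup>2 / 2) ^ 3 *
     (\<Sum>b\<in>UNIV. \<Sum>c\<in>UNIV. \<Sum>d\<in>UNIV.
        levi_civita b c d * X_flux x v 1 $ b * X_flux x v 2 $ c * X_flux x v 3 $ d)"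

definition volume :: "real \<Rightarrow> real \<Rightarrow> 'l::nontriv vertex \<Rightarrow> 'l state \<Rightarrow> real" where
  "volume a \<beta> v x = sqrt \<bar>Q_vol a \<beta> v x\<bar>"

text \<open>The matrix \<open>m\<close> stands for \<open>\<tau>\<^sub>\<mu>\<close>. On \<open>SU(2)\<close>-valued data the trace is real.\<close>

definition constr ::
  "real \<Rightarrow> real \<Rightarrow> real \<Rightarrow> mat2 \<Rightarrow> 'l::nontriv vertex \<Rightarrow> 'l state \<Rightarrow> real"
where
  "constr \<kappa> a \<beta> m v x = - (8 / (3 * \<beta> * \<kappa>\<^sup>2)) *
     (\<Sum>s1\<in>{1, - 1}. \<Sum>s2\<in>{1, - 1}. \<Sum>s3\<in>{1, - 1}.
      \<Sum>I1\<in>UNIV. \<Sum>I2\<in>UNIV. \<Sum>I3\<in>UNIV.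
        of_int (s1 * s2 * s3) * levi_civita I1 I2 I3 *
        Re (trace (m ** loop_hol x v I1 s1 I2 s2 ** hol x v I3 s3
          ** mat_bracket \<kappa> a (\<lambda>y. matrix_inv (hol y v I3 s3))
               (\<lambda>y. complex_of_real (volume a \<beta> v y)) x)))"

definition C_eucl :: "real \<Rightarrow> real \<Rightarrow> real \<Rightarrow> 'l::nontriv vertex \<Rightarrow> 'l state \<Rightarrow> real" where
  "C_eucl \<kappa> a \<beta> = constr \<kappa> a \<beta> (mat 1)"

definition C_diff :: "real \<Rightarrow> real \<Rightarrow> real \<Rightarrow> 3 \<Rightarrow> 'l::nontriv vertex \<Rightarrow> 'l state \<Rightarrow> real" where
  "C_diff \<kappa> a \<beta> j = constr \<kappa> a \<beta> (tau j)"

definition H_dust :: "real \<Rightarrow> real \<Rightarrow> real \<Rightarrow> real \<Rightarrow> 'l::nontriv state \<Rightarrow> real" where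
  "H_dust \<kappa> a \<beta> \<alpha> x =
     (\<Sum>v\<in>UNIV. sqrt \<bar>(C_eucl \<kappa> a \<beta> v x)\<^sup>2 - \<alpha> / 4 * (\<Sum>j\<in>UNIV. (C_diff \<kappa> a \<beta> j v x)\<^sup>2)\<bar>)"

definition H_scalar :: "real \<Rightarrow> real \<Rightarrow> real \<Rightarrow> 'l::nontriv state \<Rightarrow> real" where
  "H_scalar \<kappa> a \<beta> x = (\<Sum>v\<in>UNIV. sqrt \<bar>volume a \<beta> v x * C_eucl \<kappa> a \<beta> v x\<bar>)"


section \<open>Perturbed homogeneous isotropic data\<close>

text \<open>Perpendicular perturbations are meant to have vanishing \<open>I\<close>-component on \<open>e\<^sub>I(v)\<close>.\<close>

definition perturbed_vec ::
  "real \<Rightarrow> ('l::nontriv edge \<Rightarrow> real) \<Rightarrow> ('l edge \<Rightarrow> real^3) \<Rightarrow> 'l edge \<Rightarrow> real^3"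
where
  "perturbed_vec q \<delta>par \<delta>perp e = axis (snd e) (q + \<delta>par e) + \<delta>perp e"

definition perturbed_state ::
  "real \<Rightarrow> real \<Rightarrow> ('l::nontriv edge \<Rightarrow> real) \<Rightarrow> ('l edge \<Rightarrow> real^3) \<Rightarrow>
   ('l edge \<Rightarrow> real) \<Rightarrow> ('l edge \<Rightarrow> real^3) \<Rightarrow> 'l state"
where
  "perturbed_state \<theta> p \<delta>\<theta>par \<delta>\<theta>perp \<delta>ppar \<delta>pperp =
     (\<lambda>e. su2_exp (perturbed_vec \<theta> \<delta>\<theta>par \<delta>\<theta>perp e), perturbed_vec p \<delta>ppar \<delta>pperp)"

text \<open>\<open>H\<close> as a function of a single perturbation component, all others being zero; the partial
  derivatives at \<open>\<delta>\<theta> = \<delta>p = 0\<close> are the derivatives at \<open>0\<close> of these functions. In the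
  perpendicular ones \<open>b\<close> is to differ from the direction of \<open>e\<close>.\<close>

definition along_theta_par :: "('l::nontriv state \<Rightarrow> real) \<Rightarrow> real \<Rightarrow> real \<Rightarrow> 'l edge \<Rightarrow> real \<Rightarrow> real"
  where "along_theta_par H \<theta> p e t =
    H (perturbed_state \<theta> p ((\<lambda>_. 0)(e := t)) (\<lambda>_. 0) (\<lambda>_. 0) (\<lambda>_. 0))"

definition along_theta_perp ::
  "('l::nontriv state \<Rightarrow> real) \<Rightarrow> real \<Rightarrow> real \<Rightarrow> 'l edge \<Rightarrow> 3 \<Rightarrow> real \<Rightarrow> real"
  where "along_theta_perp H \<theta> p e b t =
    H (perturbed_state \<theta> p (\<lambda>_. 0) ((\<lambda>_. 0)(e := axis b t)) (\<lambda>_. 0) (\<lambda>_. 0))"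

definition along_p_par :: "('l::nontriv state \<Rightarrow> real) \<Rightarrow> real \<Rightarrow> real \<Rightarrow> 'l edge \<Rightarrow> real \<Rightarrow> real"
  where "along_p_par H \<theta> p e t =
    H (perturbed_state \<theta> p (\<lambda>_. 0) (\<lambda>_. 0) ((\<lambda>_. 0)(e := t)) (\<lambda>_. 0))"

definition along_p_perp ::
  "('l::nontriv state \<Rightarrow> real) \<Rightarrow> real \<Rightarrow> real \<Rightarrow> 'l edge \<Rightarrow> 3 \<Rightarrow> real \<Rightarrow> real"
  where "along_p_perp H \<theta> p e b t =
    H (perturbed_state \<theta> p (\<lambda>_. 0) (\<lambda>_. 0) (\<lambda>_. 0) ((\<lambda>_. 0)(e := axis b t)))"


section \<open>Evolution and constraint equations\<close>

text \<open>The absolute values and square roots in the Hamiltonians need not be differentiable where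
  \<open>sin \<theta> = 0\<close>. The next two predicates say that the derivatives entering the evolution equations
  and their reduced form exist; without them \<^const>\<open>deriv\<close> has no meaning.\<close>

definition evolution_derivs_exist :: "('l::nontriv state \<Rightarrow> real) \<Rightarrow> real \<Rightarrow> real \<Rightarrow> bool" where
  "evolution_derivs_exist H \<theta> p \<longleftrightarrow> (\<forall>v I.
     along_p_par H \<theta> p (v, I) differentiable (at 0) \<and>
     along_theta_par H \<theta> p (v, I) differentiable (at 0))"

definition hamilton_derivs_exist :: "(real \<Rightarrow> real \<Rightarrow> real) \<Rightarrow> real \<Rightarrow> real \<Rightarrow> bool" where
  "hamilton_derivs_exist G \<theta> p \<longleftrightarrow>
     (\<lambda>q. G \<theta> q) differentiable (at p) \<and> (\<lambda>u. G u p) differentiable (at \<theta>)"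

definition evolution_eqs ::
  "real \<Rightarrow> real \<Rightarrow> ('l::nontriv state \<Rightarrow> real) \<Rightarrow> (real \<Rightarrow> real) \<Rightarrow> (real \<Rightarrow> real) \<Rightarrow> real set \<Rightarrow> bool"
where
  "evolution_eqs \<kappa> a H \<theta> p T \<longleftrightarrow> (\<forall>\<tau>\<in>T. \<forall>v I.
     (\<theta> has_real_derivative - (\<kappa> / a\<^sup>2) * deriv (along_p_par H (\<theta> \<tau>) (p \<tau>) (v, I)) 0)
       (at \<tau> within T) \<and>
     (p has_real_derivative \<kappa> / a\<^sup>2 * deriv (along_theta_par H (\<theta> \<tau>) (p \<tau>) (v, I)) 0)
       (at \<tau> within T))"

text \<open>The constraint equations proper: all these partial derivatives exist and vanish.\<close>

definition constraint_eqs :: "('l::nontriv state \<Rightarrow> real) \<Rightarrow> real \<Rightarrow> real \<Rightarrow> bool" where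
  "constraint_eqs H \<theta> p \<longleftrightarrow> (\<forall>v I b. b \<noteq> I \<longrightarrow>
     (along_p_perp H \<theta> p (v, I) b has_real_derivative 0) (at 0) \<and>
     (along_theta_perp H \<theta> p (v, I) b has_real_derivative 0) (at 0))"

text \<open>The same where only some of the partial derivatives exist: those that do vanish.\<close>

definition constraint_eqs_where_defined :: "('l::nontriv state \<Rightarrow> real) \<Rightarrow> real \<Rightarrow> real \<Rightarrow> bool"
  where
  "constraint_eqs_where_defined H \<theta> p \<longleftrightarrow> (\<forall>v I b. b \<noteq> I \<longrightarrow>
     (\<forall>D. (along_p_perp H \<theta> p (v, I) b has_real_derivative D) (at 0) \<longrightarrow> D = 0) \<and>
     (\<forall>D. (along_theta_perp H \<theta> p (v, I) b has_real_derivative D) (at 0) \<longrightarrow> D = 0))"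

definition hamilton_eqs ::
  "(real \<Rightarrow> real \<Rightarrow> real) \<Rightarrow> (real \<Rightarrow> real) \<Rightarrow> (real \<Rightarrow> real) \<Rightarrow> real set \<Rightarrow> bool"
where
  "hamilton_eqs G \<theta> p T \<longleftrightarrow> (\<forall>\<tau>\<in>T.
     (\<theta> has_real_derivative - deriv (\<lambda>q. G (\<theta> \<tau>) q) (p \<tau>)) (at \<tau> within T) \<and>
     (p has_real_derivative deriv (\<lambda>u. G u (p \<tau>)) (\<theta> \<tau>)) (at \<tau> within T))"

end

theory Submission
  imports Defs
begin

text \<open>Writing holonomies as unit quaternions, the brackets \<open>h {h\<^sup>-\<^sup>1, V}\<close> become multiples of the cofactor
  vectors \<open>\<partial>V / \<partial>X\<^sub>I\<close>, so where \<open>Q\<^sub>v > 0\<close> every constraint is an explicit differentiable function of the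
  quaternions and fluxes. Since \<open>H\<close> is a translation invariant sum over vertices, its derivative with
  respect to the variable of a single edge of direction \<open>J\<close> is the derivative of the density at one
  vertex when all edges of direction \<open>J\<close> are varied simultaneously. For such translation invariant
  states the sum over the signs of the loops collapses to a commutator of quaternions: with
  \<open>h\<^sub>I = a\<^sub>I + x\<^sub>I \<cdot> \<tau>\<close>, it is \<open>8 a\<^sub>I a\<^sub>J (x\<^sub>I \<times> x\<^sub>J) \<cdot> \<tau>\<close>. The Euclidean constraint then depends on the varied
  direction only through quantities that are even in perpendicular perturbations, and the
  diffeomorphism constraints vanish at the isotropic point, where they enter quadratically. Where
  \<open>sin \<theta> = 0\<close> the Hamiltonians attain their minimum \<open>0\<close>, so every derivative that exists vanishes.\<close>


section \<open>SU(2) in quaternion coordinates\<close>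

type_synonym quaternion = "real \<times> (real^3)"

definition quat :: "quaternion \<Rightarrow> mat2" where
  "quat q = fst q *\<^sub>R mat 1 + (\<Sum>b\<in>UNIV. snd q $ b *\<^sub>R tau b)"

text \<open>Quaternion multiplication in scalar and vector parts. With \<open>tau a\<close> equal to
  -i times a Pauli matrix one has \<open>tau 1 ** tau 2 = tau 3\<close> and its cyclic versions, so
  the cross product enters with a plus sign.\<close>

definition qmul :: "quaternion \<Rightarrow> quaternion \<Rightarrow> quaternion" where
  "qmul q r = (fst q * fst r - snd q \<bullet> snd r,
     fst q *\<^sub>R snd r + fst r *\<^sub>R snd q + cross3 (snd q) (snd r))"

definition qinv :: "quaternion \<Rightarrow> quaternion" where
  "qinv q = (fst q, - snd q)"

lemma tau_entries:
  "tau 1 $ 1 $ 1 = 0" "tau 1 $ 1 $ 2 = - \<i>" "tau 1 $ 2 $ 1 = - \<i>" "tau 1 $ 2 $ 2 = 0"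
  "tau 2 $ 1 $ 1 = 0" "tau 2 $ 1 $ 2 = - 1" "tau 2 $ 2 $ 1 = 1" "tau 2 $ 2 $ 2 = 0"
  "tau 3 $ 1 $ 1 = - \<i>" "tau 3 $ 1 $ 2 = 0" "tau 3 $ 2 $ 1 = 0" "tau 3 $ 2 $ 2 = \<i>"
  by (simp_all add: tau_def pauli_def)

lemma quat_entries:
  "quat q $ 1 $ 1 = Complex (fst q) (- snd q $ 3)"
  "quat q $ 1 $ 2 = Complex (- snd q $ 2) (- snd q $ 1)"
  "quat q $ 2 $ 1 = Complex (snd q $ 2) (- snd q $ 1)"
  "quat q $ 2 $ 2 = Complex (fst q) (snd q $ 3)"
  by (simp_all add: quat_def sum_3 mat_def tau_entries complex_eq_iff)

lemma quat_mult: "quat q ** quat r = quat (qmul q r)"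
  by (simp add: vec_eq_iff forall_2 matrix_matrix_mult_def sum_2 quat_entries complex_eq_iff
      qmul_def cross3_def inner_vec_def sum_3 algebra_simps)

lemma quat_one: "mat 1 = quat (1, 0)"
  by (simp add: quat_def)

lemma quat_tau: "tau b = quat (0, axis b 1)"
  using exhaust_3[of b] by (auto simp: quat_def sum_3 axis_def)

lemma quat_linear: "linear quat"
  by (rule linearI) (simp_all add: quat_def sum.distrib scaleR_add_left scaleR_add_right scaleR_sum_right)

lemma quat_add: "quat (q + r) = quat q + quat r"
  and quat_scaleR: "quat (t *\<^sub>R q) = t *\<^sub>R quat q"
  and quat_minus: "quat (- q) = - quat q"
  and quat_sum: "quat (sum f S) = (\<Sum>i\<in>S. quat (f i))"
  using linear_add[OF quat_linear] linear_cmul[OF quat_linear] linear_neg[OF quat_linear]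
    linear_sum[OF quat_linear] by (blast, blast, blast, blast)

lemma Re_trace_quat: "Re (trace (quat q)) = 2 * fst q"
  by (simp add: trace_def sum_2 quat_entries)

lemma qmul_assoc: "qmul (qmul q r) s = qmul q (qmul r s)"
  by (simp add: prod_eq_iff qmul_def cross3_simps forall_3)

lemma qmul_bilinear: "bilinear qmul"
  unfolding bilinear_def
  by (auto intro!: linearI simp: prod_eq_iff qmul_def cross3_simps forall_3 inner_vec_def)

lemmas qmul_ladd = bilinear_ladd[OF qmul_bilinear]
  and qmul_radd = bilinear_radd[OF qmul_bilinear]
  and qmul_lscale = bilinear_lmul[OF qmul_bilinear]
  and qmul_rscale = bilinear_rmul[OF qmul_bilinear]

lemma qmul_one [simp]: "qmul (1, 0) q = q" "qmul q (1, 0) = q"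
  by (simp_all add: qmul_def)

text \<open>The norm of the product type is the Euclidean one, so the recurring condition
  \<open>norm q = 1\<close> says that \<open>quat q\<close> lies in SU(2).\<close>

lemma norm_quaternion: "(norm q)\<^sup>2 = (fst q)\<^sup>2 + snd q \<bullet> snd q" for q :: quaternion
  by (simp add: norm_prod_def power2_norm_eq_inner)

lemma qmul_qinv:
  "qmul q (qinv q) = ((norm q)\<^sup>2, 0)" "qmul (qinv q) q = ((norm q)\<^sup>2, 0)"
  by (simp_all add: qmul_def qinv_def norm_quaternion cross_minus_left cross_minus_right)
    (simp_all add: power2_eq_square)

lemma qinv_qinv [simp]: "qinv (qinv q) = q"
  by (simp add: qinv_def)

lemma norm_qinv [simp]: "norm (qinv q) = norm q"
  by (simp add: qinv_def norm_prod_def)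

lemma qinv_qmul: "qinv (qmul q r) = qmul (qinv r) (qinv q)"
  by (simp add: prod_eq_iff qmul_def qinv_def cross3_simps forall_3)

text \<open>Conjugation reverses products and a quaternion times its conjugate is a scalar, so the
  inner factor \<open>qmul r (qinv r)\<close> can be pulled out.\<close>

lemma norm_qmul: "norm (qmul q r) = norm q * norm r"
proof -
  have "((norm (qmul q r))\<^sup>2, 0) = qmul (qmul q r) (qmul (qinv r) (qinv q))"
    by (simp add: qmul_qinv(1)[symmetric] qinv_qmul)
  also have "\<dots> = qmul q (qmul (qmul r (qinv r)) (qinv q))"
    by (simp add: qmul_assoc)
  also have "\<dots> = ((norm q)\<^sup>2 * (norm r)\<^sup>2, 0)"
    using qmul_qinv(1)[of q] qmul_rscale[of q "(norm r)\<^sup>2" "qinv q"]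
    by (simp add: qmul_qinv(1)) (simp add: qmul_def)
  finally have "(norm (qmul q r))\<^sup>2 = (norm q * norm r)\<^sup>2" by (simp add: power_mult_distrib)
  then show ?thesis by simp
qed

lemma matrix_inv_quat:
  assumes "norm q = 1" shows "matrix_inv (quat q) = quat (qinv q)"
proof -
  have *: "quat q ** quat (qinv q) = mat 1" "quat (qinv q) ** quat q = mat 1"
    using assms by (simp_all add: quat_mult qmul_qinv quat_one)
  \<comment> \<open>\<open>matrix_inv\<close> is a choice: the existence of a two-sided inverse
    yields its defining property, after which associativity identifies it with the
    conjugate.\<close>
  then have "\<exists>A'. quat q ** A' = mat 1 \<and> A' ** quat q = mat 1" by blast
  then have "quat q ** matrix_inv (quat q) = mat 1 \<and> matrix_inv (quat q) ** quat q = mat 1"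
    unfolding matrix_inv_def by (rule someI_ex)
  then have "matrix_inv (quat q) = (quat (qinv q) ** quat q) ** matrix_inv (quat q)"
    using * by simp
  also have "\<dots> = quat (qinv q)"
    using \<open>_ \<and> _\<close> by (simp add: matrix_mul_assoc[symmetric])
  finally show ?thesis .
qed

section \<open>The exponential map in quaternion coordinates\<close>

lemma su2_exp_axis_quat: "su2_exp (axis b t) = quat (cos (t / 2), axis b (sin (t / 2)))"
  unfolding su2_exp_axis using exhaust_3[of b] by (auto simp: quat_def sum_3 axis_def)

text \<open>The unit vector \<open>u\<close> along \<open>x\<close> is a pure quaternion of square
  -1, so the series splits into a cosine and a sine series in \<open>s = norm x / 2\<close>, as for
  exp(i s).\<close>

lemma su2_exp_quat:
  assumes "x \<noteq> 0"
  shows "su2_exp x = quat (cos (norm x / 2), (sin (norm x / 2) / norm x) *\<^sub>R x)"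
proof -
  define s where "s = norm x / 2"
  define u where "u = (1 / norm x) *\<^sub>R x"
  have uu: "u \<bullet> u = 1"
    using assms by (simp add: u_def power2_norm_eq_inner[symmetric] power2_eq_square)
  have A: "(\<Sum>b\<in>UNIV. (x $ b / 2) *\<^sub>R tau b) = quat (0, s *\<^sub>R u)"
    using assms by (simp add: quat_def s_def u_def)
  have step: "quat (0, s *\<^sub>R u) ** quat (c, d *\<^sub>R u) = quat (- s * d, (s * c) *\<^sub>R u)" for c d
    by (simp add: quat_mult qmul_def uu cross_mult_left cross_mult_right mult.commute)
  have pow: "(((**) (quat (0, s *\<^sub>R u)) ^^ n) (mat 1)) /\<^sub>R fact n
      = quat (cos_coeff n * s ^ n, (sin_coeff n * s ^ n) *\<^sub>R u)" for n
  proof (induction n)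
    case 0
    then show ?case by (simp add: quat_one)
  next
    case (Suc n)
    have "((**) (quat (0, s *\<^sub>R u)) ^^ n) (mat 1)
        = quat (fact n * (cos_coeff n * s ^ n), (fact n * (sin_coeff n * s ^ n)) *\<^sub>R u)"
      using arg_cong[OF Suc, of "\<lambda>z. (fact n :: real) *\<^sub>R z"]
      by (simp add: quat_scaleR[symmetric])
    moreover have "inverse (fact (Suc n)) * (s * (fact n * (cos_coeff n * s ^ n))) = sin_coeff (Suc n) * s ^ Suc n"
      and "inverse (fact (Suc n)) * (- s * (fact n * (sin_coeff n * s ^ n))) = cos_coeff (Suc n) * s ^ Suc n"
      by (simp_all add: cos_coeff_Suc sin_coeff_Suc field_simps del: of_nat_Suc)
    ultimately show ?case
      by (simp add: step quat_scaleR[symmetric] del: fact_Suc power_Suc)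
  qed
  \<comment> \<open>The matrices on the right do not depend on the summation index, so only two
    scalar series remain to be summed.\<close>
  have split: "quat (c, d *\<^sub>R u) = c *\<^sub>R mat 1 + d *\<^sub>R quat (0, u)" for c d
    by (simp add: quat_one quat_scaleR[symmetric] quat_add[symmetric])
  have "(\<lambda>n. quat (cos_coeff n * s ^ n, (sin_coeff n * s ^ n) *\<^sub>R u))
      sums quat (cos s, sin s *\<^sub>R u)"
    unfolding split using cos_converges[of s] sin_converges[of s]
    by (intro sums_add sums_scaleR_left) auto
  then show ?thesis
    unfolding su2_exp_def mexp_def A pow s_def[symmetric]
    by (simp add: sums_iff u_def)
qed

section \<open>Rotation of vectors by unit quaternions\<close>

definition qrot :: "quaternion \<Rightarrow> real^3 \<Rightarrow> real^3" where
  "qrot q w = snd (qmul (qmul (qinv q) (0, w)) q)"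

lemma qmul_conj: "qmul (qmul (qinv q) (0, w)) q = (0, qrot q w)"
  by (simp add: prod_eq_iff qmul_def qinv_def qrot_def cross3_simps)

text \<open>Rodrigues' formula. The cross product carries a minus sign because the conjugate stands
  on the left, as h^{-1} does in the reversed flux.\<close>

lemma qrot_explicit:
  "qrot q w = ((fst q)\<^sup>2 - snd q \<bullet> snd q) *\<^sub>R w + (2 * (snd q \<bullet> w)) *\<^sub>R snd q
     - (2 * fst q) *\<^sub>R cross3 (snd q) w"
  by (simp add: qrot_def qmul_def qinv_def cross3_simps forall_3 power2_eq_square)

lemma qrot_linear: "linear (qrot q)"
  by (rule linearI) (simp_all add: qrot_explicit inner_add_right cross_add_right cross_mult_right algebra_simps)

lemma inner_qrot: "norm q = 1 \<Longrightarrow> qrot q v \<bullet> w = v \<bullet> qrot (qinv q) w"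
  by (simp add: qrot_explicit qinv_def inner_add_left inner_add_right inner_diff_left inner_diff_right cross_minus_left)
   (simp add: cross3_simps)

lemma qrot_qinv: assumes "norm q = 1" shows "qrot q (qrot (qinv q) w) = w"
proof -
  have "(0, qrot q (qrot (qinv q) w)) = qmul (qmul (qinv q) (qmul (qmul q (0,w)) (qinv q))) q"
    using qmul_conj[of "qinv q"] by (simp add: qmul_conj[symmetric])
  also have "\<dots> = qmul (qmul (qmul (qinv q) q) (0,w)) (qmul (qinv q) q)"
    by (simp add: qmul_assoc)
  also have "\<dots> = (0, w)" using assms by (simp add: qmul_qinv)
  finally show ?thesis by simp
qed

text \<open>A rotated orthonormal basis is again orthonormal, and this is the expansion of
  \<open>n\<close> in it. The adjoint rule \<open>inner_qrot\<close> moves the rotation onto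
  \<open>n\<close>, which reduces the claim to the standard basis.\<close>

lemma sum_inner_qrot:
  assumes "norm q = 1"
  shows "(\<Sum>b\<in>UNIV. (n \<bullet> qrot q (axis b 1)) *\<^sub>R qrot q (axis b 1)) = n"
proof -
  have "(\<Sum>b\<in>UNIV. (n \<bullet> qrot q (axis b 1)) *\<^sub>R qrot q (axis b 1))
      = qrot q (\<Sum>b\<in>UNIV. (qrot (qinv q) n \<bullet> axis b 1) *\<^sub>R axis b 1)"
    using inner_qrot[OF assms]
    by (simp add: linear_sum[OF qrot_linear] linear_cmul[OF qrot_linear] inner_commute)
  also have "(\<Sum>b\<in>UNIV. (qrot (qinv q) n \<bullet> axis b 1) *\<^sub>R axis b 1) = qrot (qinv q) n"
    by (simp add: inner_axis) (simp add: vec_eq_iff sum_3 axis_def forall_3)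
  finally show ?thesis using qrot_qinv[OF assms] by simp
qed

text \<open>Half the trace is the scalar part, and the scalar part of a product of two pure
  quaternions is minus their inner product. This is the sign by which reversed fluxes point
  backwards.\<close>

lemma rev_flux_quat:
  assumes "norm q = 1" shows "rev_flux (quat q) p = - qrot q p"
proof -
  have "(\<Sum>b\<in>UNIV. p $ b *\<^sub>R tau b) = quat (0, p)" by (simp add: quat_def)
  moreover have "tau b ** matrix_inv (quat q) ** quat (0, p) ** quat q
      = quat (qmul (0, axis b 1) (0, qrot q p))" for b
    using assms by (simp add: matrix_inv_quat quat_tau quat_mult qmul_assoc flip: qmul_conj)
  ultimately have "rev_flux (quat q) p $ b = - qrot q p $ b" for b
    by (simp add: rev_flux_def Re_trace_quat) (simp add: qmul_def inner_axis')
  then show ?thesis by (simp add: vec_eq_iff)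
qed


section \<open>The constraints in closed form\<close>

definition qstate :: "('l::nontriv edge \<Rightarrow> quaternion) \<Rightarrow> ('l edge \<Rightarrow> real^3) \<Rightarrow> 'l state" where
  "qstate q p = (\<lambda>e. quat (q e), p)"

text \<open>The positively oriented lattice edge that stores the data of the edge leaving
  \<open>v\<close> in direction \<open>I\<close> with sign \<open>s\<close>.\<close>

definition sedge :: "'l::nontriv vertex \<Rightarrow> 3 \<Rightarrow> int \<Rightarrow> 'l edge" where
  "sedge v I s = (if s = 1 then (v, I) else (shift v I (- 1), I))"

definition qhol :: "('l::nontriv edge \<Rightarrow> quaternion) \<Rightarrow> 'l vertex \<Rightarrow> 3 \<Rightarrow> int \<Rightarrow> quaternion" where
  "qhol q v I s = (if s = 1 then q (v, I) else qinv (q (shift v I (- 1), I)))"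

definition qloop ::
  "('l::nontriv edge \<Rightarrow> quaternion) \<Rightarrow> 'l vertex \<Rightarrow> 3 \<Rightarrow> int \<Rightarrow> 3 \<Rightarrow> int \<Rightarrow> quaternion" where
  "qloop q v I s J s' = qmul (qmul (qmul (qhol q v I s) (qhol q (shift v I s) J s'))
     (qinv (qhol q (shift v J s') I s))) (qinv (qhol q v J s'))"

text \<open>The plus sign comes from the difference in \<open>X_flux\<close> together with the minus
  sign in \<open>rev_flux_quat\<close>.\<close>

definition qX :: "('l::nontriv edge \<Rightarrow> quaternion) \<Rightarrow> ('l edge \<Rightarrow> real^3) \<Rightarrow> 'l vertex \<Rightarrow> 3 \<Rightarrow> real^3" where
  "qX q p v I = (1 / 2) *\<^sub>R
     (p (v, I) + qrot (q (shift v I (- 1), I)) (p (shift v I (- 1), I)))"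

definition triple :: "(3 \<Rightarrow> real^3) \<Rightarrow> real" where
  "triple X = X 1 \<bullet> cross3 (X 2) (X 3)"

text \<open>The gradient of the determinant \<open>triple X\<close> with respect to its row
  \<open>X I\<close>.\<close>

definition cofactor :: "(3 \<Rightarrow> real^3) \<Rightarrow> 3 \<Rightarrow> real^3" where
  "cofactor X I = (if I = 1 then cross3 (X 2) (X 3) else if I = 2 then cross3 (X 3) (X 1)
     else cross3 (X 1) (X 2))"

text \<open>A determinant is affine in each single row, so there are no terms of higher order in
  \<open>w\<close>.\<close>

lemma triple_update: "triple (\<lambda>J. X J + (if J = I then w else 0)) = triple X + cofactor X I \<bullet> w"
  using exhaust_3[of I]
  by (auto simp: triple_def cofactor_def cross3_simps)

text \<open>This is where L > 1 enters, through -1 being nonzero in Z/L. The two edges of direction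
  \<open>I\<close> at \<open>v\<close> therefore differ, and changing the flux on one of them leaves
  the other alone.\<close>

lemma shift_ne: "shift v I (- 1) \<noteq> (v :: 'l::nontriv vertex)"
proof
  assume "shift v I (- 1) = v"
  then have "axis I (- 1) $ I = (0 :: 'l mod_ring^3) $ I" by (simp add: shift_def)
  then show False by simp
qed

lemma hol_qstate: "(\<And>e. norm (q e) = 1) \<Longrightarrow> hol (qstate q p) v I s = quat (qhol q v I s)"
  by (simp add: hol_def qstate_def qhol_def matrix_inv_quat)

lemma norm_qhol: "(\<And>e. norm (q e) = 1) \<Longrightarrow> norm (qhol q v I s) = 1"
  by (simp add: qhol_def)

lemma loop_hol_qstate:
  "(\<And>e. norm (q e) = 1) \<Longrightarrow> loop_hol (qstate q p) v I s J s' = quat (qloop q v I s J s')"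
  by (simp add: loop_hol_def hol_qstate qloop_def matrix_inv_quat norm_qhol quat_mult)

lemma X_flux_qstate: "(\<And>e. norm (q e) = 1) \<Longrightarrow> X_flux (qstate q p) v I = qX q p v I"
  by (simp add: X_flux_def flux_def qstate_def rev_flux_quat qX_def)

lemma Q_vol_triple: "Q_vol a \<beta> v x = (\<beta> * a\<^sup>2 / 2) ^ 3 * triple (X_flux x v)"
  by (simp add: Q_vol_def triple_def sum_3 levi_civita_def cross3_simps)

lemma volume_qstate:
  "(\<And>e. norm (q e) = 1) \<Longrightarrow> volume a \<beta> v (qstate q p) = sqrt \<bar>(\<beta> * a\<^sup>2 / 2) ^ 3 * triple (qX q p v)\<bar>"
proof -
  assume *: "\<And>e. norm (q e) = 1"
  have "X_flux (qstate q p) v = qX q p v" using X_flux_qstate[of q, OF *] by auto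
  then show ?thesis by (simp add: volume_def Q_vol_triple)
qed

section \<open>Poisson brackets of holonomies with the volume\<close>

lemma d_flux_volume:
  fixes v :: "'l::nontriv vertex"
  assumes unit: "\<And>e. norm (q e) = 1" and pos: "triple (qX q p v) > 0"
    and "a > 0" "\<beta> > 0" and s: "s = 1 \<or> s = - 1"
  shows "d_flux (sedge v I s) b (\<lambda>y. complex_of_real (volume a \<beta> v y)) (qstate q p)
    = of_real (sqrt ((\<beta> * a\<^sup>2 / 2) ^ 3) / (4 * sqrt (triple (qX q p v)))
        * (cofactor (qX q p v) I \<bullet> (if s = 1 then axis b 1 else qrot (q (sedge v I s)) (axis b 1))))"
proof -
  define k where "k = (\<beta> * a\<^sup>2 / 2) ^ 3"
  define D where "D = triple (qX q p v)"
  define w where "w = (if s = 1 then axis b 1 else qrot (q (sedge v I s)) (axis b 1))"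
  define c where "c = cofactor (qX q p v) I \<bullet> w"
  have k: "k > 0" using assms by (simp add: k_def)
  have D: "D > 0" using pos by (simp add: D_def)
  have ax: "axis b t = t *\<^sub>R (axis b 1 :: real^3)" for t
    by (simp add: vec_eq_iff axis_def)
  \<comment> \<open>Only the vector of direction \<open>I\<close> moves. The factor 1/2 is that of
    the mean of the two fluxes, and a variation on the incoming edge is seen through the
    rotation.\<close>
  have "qX q (p(sedge v I s := p (sedge v I s) + axis b t)) v
      = (\<lambda>J. qX q p v J + (if J = I then (t / 2) *\<^sub>R w else 0))" for t
    using s shift_ne[of v I] shift_ne[of v I, symmetric]
    by (auto simp: qX_def sedge_def w_def fun_eq_iff ax[of t] linear_add[OF qrot_linear]
        linear_cmul[OF qrot_linear] algebra_simps)
  then have vol: "volume a \<beta> v (fst (qstate q p), (snd (qstate q p))(sedge v I s :=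
      snd (qstate q p) (sedge v I s) + axis b t)) = sqrt \<bar>k * (D + t / 2 * c)\<bar>" for t
    using volume_qstate[of q a \<beta> v "p(sedge v I s := p (sedge v I s) + axis b t)"] unit
    by (simp add: triple_update qstate_def k_def D_def c_def)
  have "((\<lambda>t. sqrt (k * (D + t / 2 * c))) has_real_derivative k * (c / 2) / (2 * sqrt (k * D))) (at 0)"
    using mult_pos_pos[OF k D] by (auto intro!: derivative_eq_intros simp: field_simps)
  moreover have "\<forall>\<^sub>F t in nhds 0. sqrt \<bar>k * (D + t / 2 * c)\<bar> = sqrt (k * (D + t / 2 * c))"
  proof -
    have "continuous_on UNIV (\<lambda>t. k * (D + t / 2 * c))" by (intro continuous_intros) simp
    then have "open {t. 0 < k * (D + t / 2 * c)}" by (intro open_Collect_less) auto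
    then have "\<forall>\<^sub>F t in nhds 0. k * (D + t / 2 * c) > 0"
      using k D eventually_nhds_in_open[of "{t. 0 < k * (D + t / 2 * c)}" 0] by simp
    then show ?thesis by eventually_elim simp
  qed
  ultimately have "((\<lambda>t. sqrt \<bar>k * (D + t / 2 * c)\<bar>) has_real_derivative k * (c / 2) / (2 * sqrt (k * D))) (at 0)"
    by (subst DERIV_cong_ev[OF refl _ refl])
  then have "((\<lambda>t. complex_of_real (sqrt \<bar>k * (D + t / 2 * c)\<bar>)) has_vector_derivative
      of_real (k * (c / 2) / (2 * sqrt (k * D)))) (at 0)"
    by (intro has_vector_derivative_of_real) (simp add: has_real_derivative_iff_has_vector_derivative)
  then have "d_flux (sedge v I s) b (\<lambda>y. complex_of_real (volume a \<beta> v y)) (qstate q p)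
      = of_real (k * (c / 2) / (2 * sqrt (k * D)))"
    unfolding d_flux_def vol by (rule vector_derivative_at)
  also have "k * (c / 2) / (2 * sqrt (k * D)) = sqrt k / (4 * sqrt D) * c"
    using k D by (simp add: real_sqrt_mult field_simps)
  finally show ?thesis by (simp add: k_def D_def c_def w_def)
qed

text \<open>The flow multiplies h(e) from the left by exp(t \<tau>/2). For \<open>s = 1\<close> the
  inverse holonomy is the conjugate, so the exponential appears inverted and on the right. For
  \<open>s = - 1\<close> the inverse of the reversed holonomy is h(e) itself, so it stays on the
  left.\<close>

lemma d_hol_inv_hol:
  fixes v :: "'l::nontriv vertex"
  assumes unit: "\<And>e. norm (q e) = 1" and s: "s = 1 \<or> s = - 1"
  shows "d_hol e b (\<lambda>y. matrix_inv (hol y v I s) $ i $ j) (qstate q p) =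
    (if e = sedge v I s then
       (if s = 1 then - (quat (qmul (qinv (q e)) (0, axis b 1)) $ i $ j) / 2
        else quat (qmul (0, axis b 1) (q e)) $ i $ j / 2) else 0)"
proof (cases "e = sedge v I s")
  case False
  then have "hol ((fst x)(e := h), snd x) v I s = hol x v I s" for x h
    using s by (auto simp: hol_def sedge_def)
  with False show ?thesis by (simp add: d_hol_def)
next
  case True
  define g where "g t = (cos (t / 2), axis b (sin (t / 2)) :: real^3)" for t :: real
  have g1: "norm (g t) = 1" for t
  proof -
    have "(norm (g t))\<^sup>2 = 1" by (simp add: norm_quaternion g_def inner_axis_axis power2_eq_square[symmetric])
    then show ?thesis by (simp add: power2_eq_1_iff) (smt (verit) norm_ge_zero)
  qed
  have g: "g t = cos (t / 2) *\<^sub>R (1, 0) + sin (t / 2) *\<^sub>R (0, axis b 1)" for t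
    by (simp add: g_def vec_eq_iff axis_def)
  have gi: "qinv (g t) = cos (t / 2) *\<^sub>R (1, 0) - sin (t / 2) *\<^sub>R (0, axis b 1)" for t
    by (simp add: g_def qinv_def vec_eq_iff axis_def)
  define A where "A = (if s = 1 then qinv (q e) else q e)"
  define B where "B = (if s = 1 then - qmul (qinv (q e)) (0, axis b 1) else qmul (0, axis b 1) (q e))"
  have curve: "matrix_inv (hol ((fst (qstate q p))(e := su2_exp (axis b t) ** fst (qstate q p) e),
      snd (qstate q p)) v I s) $ i $ j
      = cos (t / 2) *\<^sub>R (quat A $ i $ j) + sin (t / 2) *\<^sub>R (quat B $ i $ j)" for t
  proof -
    have fe: "su2_exp (axis b t) ** quat (q e) = quat (qmul (g t) (q e))" for e
      by (simp add: su2_exp_axis_quat g_def quat_mult)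
    have n: "norm (qmul (g t) (q e)) = 1" using g1 unit by (simp add: norm_qmul)
    have "matrix_inv (hol ((fst (qstate q p))(e := su2_exp (axis b t) ** fst (qstate q p) e),
        snd (qstate q p)) v I s) = quat (if s = 1 then qinv (qmul (g t) (q e)) else qmul (g t) (q e))"
      using s True n unfolding hol_def
      by (auto simp: qstate_def fe sedge_def matrix_inv_quat)
    also have "(if s = 1 then qinv (qmul (g t) (q e)) else qmul (g t) (q e))
        = cos (t / 2) *\<^sub>R A + sin (t / 2) *\<^sub>R B"
      using s by (cases "s = 1")
        (simp_all add: A_def B_def qinv_qmul gi bilinear_rsub[OF qmul_bilinear] qmul_rscale del: scaleR_Pair,
         simp add: g qmul_ladd qmul_lscale del: scaleR_Pair)
    also have "quat \<dots> = cos (t / 2) *\<^sub>R quat A + sin (t / 2) *\<^sub>R quat B"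
      by (simp add: quat_add quat_scaleR)
    finally show ?thesis by (simp only: vector_add_component vector_scaleR_component)
  qed
  have "((\<lambda>t. cos (t / 2) *\<^sub>R (quat A $ i $ j) + sin (t / 2) *\<^sub>R (quat B $ i $ j))
      has_vector_derivative quat B $ i $ j / 2) (at 0)"
    by (auto intro!: derivative_eq_intros simp: scaleR_conv_of_real)
  then have "d_hol e b (\<lambda>y. matrix_inv (hol y v I s) $ i $ j) (qstate q p) = quat B $ i $ j / 2"
    unfolding d_hol_def curve by (rule vector_derivative_at)
  also have "quat B $ i $ j = (if s = 1 then - (quat (qmul (qinv (q e)) (0, axis b 1)) $ i $ j)
      else quat (qmul (0, axis b 1) (q e)) $ i $ j)"
    by (simp add: B_def quat_minus)
  finally show ?thesis using True by (cases "s = 1") (simp_all only: if_True if_False refl)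
qed

text \<open>Multiplying by the holonomy turns the derivative of its inverse into exactly the vector
  \<open>w b\<close> that also occurs in the flux derivative of the volume. The sum over
  \<open>b\<close> then expands the cofactor vector in an orthonormal basis, and of the orientation
  only the sign \<open>s\<close> survives.\<close>

lemma hol_bracket_volume:
  fixes v :: "'l::nontriv vertex"
  assumes unit: "\<And>e. norm (q e) = 1" and pos: "triple (qX q p v) > 0"
    and "a > 0" "\<beta> > 0" and s: "s = 1 \<or> s = - 1"
  shows "hol (qstate q p) v I s ** mat_bracket \<kappa> a (\<lambda>y. matrix_inv (hol y v I s))
      (\<lambda>y. complex_of_real (volume a \<beta> v y)) (qstate q p)
    = quat (0, (of_int s * \<kappa> * sqrt ((\<beta> * a\<^sup>2 / 2) ^ 3) / (8 * a\<^sup>2 * sqrt (triple (qX q p v))))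
        *\<^sub>R cofactor (qX q p v) I)"
proof -
  define e where "e = sedge v I s"
  define N where "N = cofactor (qX q p v) I"
  define c where "c = sqrt ((\<beta> * a\<^sup>2 / 2) ^ 3) / (4 * sqrt (triple (qX q p v)))"
  define w where "w b = (if s = 1 then axis b 1 else qrot (q e) (axis b 1))" for b
  define B where "B b = (if s = 1 then qmul (qinv (q e)) (0, axis b 1) else - qmul (0, axis b 1) (q e))" for b
  have dV: "d_flux e b (\<lambda>y. complex_of_real (volume a \<beta> v y)) (qstate q p) = of_real (c * (N \<bullet> w b))" for b
    using d_flux_volume[OF assms, of I b] by (simp add: e_def N_def c_def w_def)
  have dh: "d_hol e' b (\<lambda>y. matrix_inv (hol y v I s) $ i $ j) (qstate q p)
      = (if e' = e then - (quat (B b) $ i $ j) / 2 else 0)" for e' b i j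
    using d_hol_inv_hol[OF unit s, where e = e' and b = b and v = v and I = I and i = i and j = j and p = p] s by (auto simp: e_def B_def quat_minus)
  \<comment> \<open>Holonomies do not depend on fluxes, so of the three terms of the bracket only
    the holonomy derivative times the flux derivative of the volume is left.\<close>
  have df: "d_flux e' b (\<lambda>y. matrix_inv (hol y v I s) $ i $ j) x = 0" for e' b i j and x :: "'l state"
    by (simp add: d_flux_def hol_def cong: if_cong)
  have "bracket \<kappa> a (\<lambda>y. matrix_inv (hol y v I s) $ i $ j)
      (\<lambda>y. complex_of_real (volume a \<beta> v y)) (qstate q p)
    = of_real (\<kappa> / a\<^sup>2) * (\<Sum>b\<in>UNIV. quat (B b) $ i $ j / 2 * of_real (c * (N \<bullet> w b)))" for i j
  proof -
    have "(\<Sum>e'\<in>UNIV. \<Sum>b\<in>UNIV. d_hol e' b (\<lambda>y. matrix_inv (hol y v I s) $ i $ j) (qstate q p)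
          * d_flux e' b (\<lambda>y. complex_of_real (volume a \<beta> v y)) (qstate q p))
      = (\<Sum>e'\<in>UNIV. if e' = e then - (\<Sum>b\<in>UNIV. quat (B b) $ i $ j / 2 * of_real (c * (N \<bullet> w b))) else 0)"
      by (intro sum.cong refl) (auto simp: dh dV sum_negf)
    then show ?thesis by (simp add: bracket_def df sum_negf)
  qed
  then have "mat_bracket \<kappa> a (\<lambda>y. matrix_inv (hol y v I s))
      (\<lambda>y. complex_of_real (volume a \<beta> v y)) (qstate q p)
    = quat (\<Sum>b\<in>UNIV. (\<kappa> / a\<^sup>2 * c / 2 * (N \<bullet> w b)) *\<^sub>R B b)"
    by (simp add: mat_bracket_def vec_eq_iff quat_sum quat_scaleR sum_distrib_left)
      (intro allI sum.cong refl, simp add: scaleR_conv_of_real)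
  \<comment> \<open>For \<open>s = 1\<close> the holonomy cancels against its inverse. For
    \<open>s = - 1\<close> the product is a conjugation, hence a rotation of the basis
    vector.\<close>
  moreover have qB: "qmul (qhol q v I s) (B b) = of_int s *\<^sub>R (0, w b)" for b
  proof (cases "s = 1")
    case True
    then show ?thesis
      using unit qmul_assoc[of "q e" "qinv (q e)" "(0, axis b 1)"]
      by (simp add: qhol_def B_def w_def e_def sedge_def qmul_qinv)
  next
    case False
    with s have "s = - 1" by simp
    then show ?thesis
      using qmul_conj[of "q e" "axis b 1"]
      by (simp add: qhol_def B_def w_def e_def sedge_def qmul_assoc bilinear_rneg[OF qmul_bilinear])
  qed
  ultimately have "hol (qstate q p) v I s ** mat_bracket \<kappa> a (\<lambda>y. matrix_inv (hol y v I s))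
      (\<lambda>y. complex_of_real (volume a \<beta> v y)) (qstate q p)
    = quat (\<Sum>b\<in>UNIV. (\<kappa> / a\<^sup>2 * c / 2 * (N \<bullet> w b)) *\<^sub>R of_int s *\<^sub>R (0::real, w b))"
    by (simp add: hol_qstate unit quat_mult bilinear_sum)
      (simp add: linear_sum[OF qmul_bilinear[unfolded bilinear_def, THEN conjunct1, rule_format]] qmul_rscale qB)
  also have "(\<Sum>b\<in>UNIV. (\<kappa> / a\<^sup>2 * c / 2 * (N \<bullet> w b)) *\<^sub>R of_int s *\<^sub>R (0::real, w b))
      = (0, (\<kappa> / a\<^sup>2 * c / 2 * of_int s) *\<^sub>R (\<Sum>b\<in>UNIV. (N \<bullet> w b) *\<^sub>R w b))"
    by (simp add: prod_eq_iff fst_sum snd_sum scaleR_sum_right)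
      (intro sum.cong refl, simp)
  also have "(\<Sum>b\<in>UNIV. (N \<bullet> w b) *\<^sub>R w b) = N"
  proof (cases "s = 1")
    case True
    then show ?thesis by (simp add: w_def inner_axis) (simp add: vec_eq_iff sum_3 axis_def forall_3)
  next
    case False
    then show ?thesis using sum_inner_qrot[OF unit] by (simp add: w_def)
  qed
  finally show ?thesis by (simp add: N_def c_def field_simps)
qed

text \<open>The constraint with its brackets evaluated and the sum over \<open>s3\<close> carried
  out: the bracket contributes a factor \<open>s3\<close> that cancels the explicit one. Unlike the
  brackets, this expression is visibly differentiable in the quaternions and fluxes where
  \<open>triple\<close> is positive.\<close>

definition closed_constr ::
  "real \<Rightarrow> real \<Rightarrow> real \<Rightarrow> quaternion \<Rightarrow> 'l::nontriv vertex \<Rightarrow> ('l edge \<Rightarrow> quaternion) \<Rightarrow> ('l edge \<Rightarrow> real^3) \<Rightarrow> real"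
where
  "closed_constr \<kappa> a \<beta> m v q p =
     - (4 * sqrt ((\<beta> * a\<^sup>2 / 2) ^ 3) / (3 * \<beta> * \<kappa> * a\<^sup>2)) / sqrt (triple (qX q p v)) *
     (\<Sum>I1\<in>UNIV. \<Sum>I2\<in>UNIV. \<Sum>I3\<in>UNIV. levi_civita I1 I2 I3 *
       fst (qmul (qmul m (\<Sum>s1\<in>{1, - 1}. \<Sum>s2\<in>{1, - 1}. of_int (s1 * s2) *\<^sub>R qloop q v I1 s1 I2 s2))
         (0, cofactor (qX q p v) I3)))"

lemma fst_qmul_scale: "fst (qmul r (0, t *\<^sub>R n)) = t * fst (qmul r (0, n))"
  by (simp add: qmul_def)

lemma constr_qstate:
  assumes unit: "\<And>e. norm (q e) = 1" and pos: "triple (qX q p v) > 0"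
    and "\<kappa> > 0" "a > 0" "\<beta> > 0"
  shows "constr \<kappa> a \<beta> (quat m) v (qstate q p) = closed_constr \<kappa> a \<beta> m v q p"
proof -
  define c where "c = \<kappa> * sqrt ((\<beta> * a\<^sup>2 / 2) ^ 3) / (8 * a\<^sup>2 * sqrt (triple (qX q p v)))"
  define N where "N = cofactor (qX q p v)"
  have tr: "Re (trace (quat m ** loop_hol (qstate q p) v I1 s1 I2 s2 ** hol (qstate q p) v I3 s3
          ** mat_bracket \<kappa> a (\<lambda>y. matrix_inv (hol y v I3 s3))
               (\<lambda>y. complex_of_real (volume a \<beta> v y)) (qstate q p)))
     = of_int s3 * (2 * c) * fst (qmul (qmul m (qloop q v I1 s1 I2 s2)) (0, N I3))"
    if "s3 = 1 \<or> s3 = - 1" for I1 s1 I2 s2 I3 s3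
  proof -
    have "quat m ** loop_hol (qstate q p) v I1 s1 I2 s2 ** hol (qstate q p) v I3 s3
          ** mat_bracket \<kappa> a (\<lambda>y. matrix_inv (hol y v I3 s3))
               (\<lambda>y. complex_of_real (volume a \<beta> v y)) (qstate q p)
      = quat (qmul (qmul m (qloop q v I1 s1 I2 s2)) (0, (of_int s3 * c) *\<^sub>R N I3))"
      using hol_bracket_volume[OF unit pos \<open>a > 0\<close> \<open>\<beta> > 0\<close> that, of I3 \<kappa>]
      by (simp add: loop_hol_qstate unit quat_mult c_def N_def mult.assoc flip: matrix_mul_assoc qmul_assoc)
    then show ?thesis
      by (simp add: Re_trace_quat fst_qmul_scale)
  qed
  have "constr \<kappa> a \<beta> (quat m) v (qstate q p) = - (8 / (3 * \<beta> * \<kappa>\<^sup>2)) *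
     (\<Sum>s1\<in>{1, - 1}. \<Sum>s2\<in>{1, - 1}. \<Sum>s3\<in>{1, - 1}.
      \<Sum>I1\<in>UNIV. \<Sum>I2\<in>UNIV. \<Sum>I3\<in>UNIV.
        of_int (s1 * s2 * s3) * levi_civita I1 I2 I3 *
        (of_int s3 * (2 * c) * fst (qmul (qmul m (qloop q v I1 s1 I2 s2)) (0, N I3))))"
    unfolding constr_def by (intro arg_cong2[where f="(*)"] refl sum.cong) (auto simp: tr)
  \<comment> \<open>The factor 4 is the 2 from the trace times the two equal contributions of
    \<open>s3\<close>.\<close>
  also have "\<dots> = - (8 / (3 * \<beta> * \<kappa>\<^sup>2)) * (4 * c) *
    (\<Sum>I1\<in>UNIV. \<Sum>I2\<in>UNIV. \<Sum>I3\<in>UNIV. levi_civita I1 I2 I3 *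
       fst (qmul (qmul m (\<Sum>s1\<in>{1, - 1}. \<Sum>s2\<in>{1, - 1}. of_int (s1 * s2) *\<^sub>R qloop q v I1 s1 I2 s2)) (0, N I3)))"
    by (simp add: sum_3 levi_civita_def qmul_radd qmul_ladd qmul_lscale qmul_rscale
        bilinear_rneg[OF qmul_bilinear] bilinear_lneg[OF qmul_bilinear]
        bilinear_rsub[OF qmul_bilinear] bilinear_lsub[OF qmul_bilinear])
      (simp add: algebra_simps)
  also have "- (8 / (3 * \<beta> * \<kappa>\<^sup>2)) * (4 * c)
      = - (4 * sqrt ((\<beta> * a\<^sup>2 / 2) ^ 3) / (3 * \<beta> * \<kappa> * a\<^sup>2)) / sqrt (triple (qX q p v))"
    using assms by (simp add: c_def field_simps power2_eq_square)
  finally show ?thesis by (simp add: closed_constr_def N_def)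
qed


section \<open>Derivatives with respect to one edge variable\<close>

lemma differentiable_linear:
  fixes L :: "'b::euclidean_space \<Rightarrow> 'c::real_normed_vector"
  assumes "linear L" "f differentiable F"
  shows "(\<lambda>x. L (f x)) differentiable F"
  using assms bounded_linear.has_derivative[OF linear_conv_bounded_linear[THEN iffD1, OF assms(1)]]
  unfolding differentiable_def by blast

lemma differentiable_bilinear:
  fixes B :: "'b::euclidean_space \<Rightarrow> 'c::euclidean_space \<Rightarrow> 'd::real_normed_vector"
  assumes "bilinear B" "f differentiable (at z within S)" "g differentiable (at z within S)"
  shows "(\<lambda>x. B (f x) (g x)) differentiable (at z within S)"
  using assms bounded_bilinear.FDERIV[OF bilinear_conv_bounded_bilinear[THEN iffD1, OF assms(1)]]
  unfolding differentiable_def by blast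

lemma differentiable_sqrt:
  fixes f :: "'a::real_normed_vector \<Rightarrow> real"
  assumes "f differentiable (at z)" "f z > 0"
  shows "(\<lambda>x. sqrt (f x)) differentiable (at z)"
  using assms has_derivative_real_sqrt unfolding differentiable_def by blast

lemma differentiable_sqrt_abs:
  fixes f :: "'a::real_normed_vector \<Rightarrow> real"
  assumes "f differentiable (at z)" "f z > 0"
  shows "(\<lambda>x. sqrt \<bar>f x\<bar>) differentiable (at z)"
proof -
  have "\<forall>\<^sub>F x in nhds (f z). x > 0"
    using assms(2) eventually_nhds_in_open[of "{0<..}" "f z"] by simp
  then have "((\<lambda>x. \<bar>x\<bar>) has_real_derivative 1) (at (f z))"
    using assms(2) by (subst DERIV_cong_ev[OF refl _ refl, where g = "\<lambda>x. x"])
      (auto elim: eventually_mono)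
  then have "(\<lambda>x. \<bar>x\<bar>) differentiable (at (f z))"
    by (auto simp: real_differentiable_def)
  then have "(\<lambda>x. \<bar>f x\<bar>) differentiable (at z)"
    using assms(1) differentiable_chain_at[of f z abs] by (simp add: o_def)
  then show ?thesis using assms(2) by (intro differentiable_sqrt) auto
qed

lemma linear_qinv: "linear qinv"
  by (rule linearI) (simp_all add: qinv_def)

lemma differentiable_qinv:
  "f differentiable F \<Longrightarrow> (\<lambda>x. qinv (f x)) differentiable F"
  by (rule differentiable_linear[OF linear_qinv])

lemma differentiable_qmul:
  "f differentiable (at z) \<Longrightarrow> g differentiable (at z) \<Longrightarrow> (\<lambda>x. qmul (f x) (g x)) differentiable (at z)"
  by (rule differentiable_bilinear[OF qmul_bilinear])

lemma differentiable_cross3: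
  "f differentiable (at z) \<Longrightarrow> g differentiable (at z) \<Longrightarrow> (\<lambda>x. cross3 (f x) (g x)) differentiable (at z)"
  by (rule differentiable_bilinear[OF bilinear_cross])

lemma differentiable_fst:
  fixes f :: "'a::real_normed_vector \<Rightarrow> 'b::euclidean_space \<times> 'c::euclidean_space"
  shows "f differentiable F \<Longrightarrow> (\<lambda>x. fst (f x)) differentiable F"
  by (rule differentiable_linear[OF linear_fst])

lemma differentiable_snd:
  fixes f :: "'a::real_normed_vector \<Rightarrow> 'b::euclidean_space \<times> 'c::euclidean_space"
  shows "f differentiable F \<Longrightarrow> (\<lambda>x. snd (f x)) differentiable F"
  by (rule differentiable_linear[OF linear_snd])

lemma differentiable_qrot:
  "f differentiable (at z) \<Longrightarrow> g differentiable (at z) \<Longrightarrow> (\<lambda>x. qrot (f x) (g x)) differentiable (at z)"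
  unfolding qrot_def by (intro differentiable_snd differentiable_qmul differentiable_qinv differentiable_Pair) auto

lemma differentiable_qX:
  assumes "\<And>e. (\<lambda>x. q x e) differentiable (at z)" "\<And>e. (\<lambda>x. p x e) differentiable (at z)"
  shows "(\<lambda>x. qX (q x) (p x) v I) differentiable (at z)"
  unfolding qX_def
  by (intro differentiable_scaleR differentiable_add differentiable_qrot assms differentiable_const)

lemma differentiable_triple_qX:
  assumes "\<And>e. (\<lambda>x. q x e) differentiable (at z)" "\<And>e. (\<lambda>x. p x e) differentiable (at z)"
  shows "(\<lambda>x. triple (qX (q x) (p x) v)) differentiable (at z)"
  unfolding triple_def
  by (intro differentiable_inner differentiable_cross3 differentiable_qX assms)

lemma differentiable_closed_constr:
  assumes q: "\<And>e. (\<lambda>x. q x e) differentiable (at z)" and p: "\<And>e. (\<lambda>x. p x e) differentiable (at z)"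
    and pos: "triple (qX (q z) (p z) v) > 0"
  shows "(\<lambda>x. closed_constr \<kappa> a \<beta> m v (q x) (p x)) differentiable (at z)"
proof -
  have hol: "(\<lambda>x. qhol (q x) w I s) differentiable (at z)" for w I s
    using q by (cases "s = 1") (auto simp: qhol_def intro!: differentiable_qinv)
  have loop: "(\<lambda>x. qloop (q x) v I s J s') differentiable (at z)" for I s J s'
    unfolding qloop_def by (intro differentiable_qmul differentiable_qinv hol)
  have cof: "(\<lambda>x. cofactor (qX (q x) (p x) v) I) differentiable (at z)" for I
    using exhaust_3[of I]
    by (auto simp: cofactor_def intro!: differentiable_cross3 differentiable_qX q p)
  show ?thesis unfolding closed_constr_def
    by (intro differentiable_mult differentiable_divide differentiable_sum differentiable_fst
        differentiable_qmul differentiable_scaleR differentiable_Pair loop cof differentiable_const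
        differentiable_sqrt differentiable_triple_qX q p ballI finite_class.finite_UNIV)
      (use pos in auto)
qed

section \<open>Lattice translations and reduction to one vertex\<close>

definition translate :: "'l::nontriv vertex \<Rightarrow> ('l edge \<Rightarrow> 'b) \<Rightarrow> 'l edge \<Rightarrow> 'b" where
  "translate u F e = F (fst e + u, snd e)"

lemma shift_add: "shift (v + u) I s = shift v I s + u"
  by (simp add: shift_def)

lemma qX_translate: "qX q p (v + u) = qX (translate u q) (translate u p) v"
  by (simp add: qX_def translate_def shift_add fun_eq_iff)

lemma qhol_translate: "qhol q (v + u) I s = qhol (translate u q) v I s"
  by (simp add: qhol_def translate_def shift_add)

lemma qloop_translate: "qloop q (v + u) I s J s' = qloop (translate u q) v I s J s'"
  by (simp add: qloop_def shift_add qhol_translate)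

lemma closed_constr_translate:
  "closed_constr \<kappa> a \<beta> m (v + u) q p = closed_constr \<kappa> a \<beta> m v (translate u q) (translate u p)"
  by (simp only: closed_constr_def qX_translate qloop_translate)

text \<open>By symmetry all partial derivatives at 0 are equal, and by full differentiability their
  sum is the derivative along the diagonal. Each is therefore the diagonal derivative divided by the
  dimension.\<close>

lemma vec_derivative_axis:
  fixes \<phi> :: "real^'n \<Rightarrow> real"
  assumes diff: "\<phi> differentiable (at 0)"
    and sym: "\<And>w w' t. \<phi> (axis w t) = \<phi> (axis w' t)"
    and tot: "((\<lambda>t. \<phi> (vec t)) has_real_derivative (real CARD('n) * D)) (at 0)"
  shows "((\<lambda>t. \<phi> (axis w t)) has_real_derivative D) (at 0)"
proof -
  obtain L where L: "(\<phi> has_derivative L) (at 0)"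
    using diff by (auto simp: differentiable_def)
  have lin: "linear L" using L has_derivative_linear by blast
  have dir: "((\<lambda>t. \<phi> (t *\<^sub>R x)) has_real_derivative L x) (at 0)" for x
  proof -
    have "((\<lambda>t::real. t *\<^sub>R x) has_derivative (\<lambda>t. t *\<^sub>R x)) (at 0)"
      by (auto intro!: derivative_eq_intros)
    moreover have "(\<phi> has_derivative L) (at (0 *\<^sub>R x))" using L by simp
    ultimately have "((\<lambda>t. \<phi> (t *\<^sub>R x)) has_derivative (\<lambda>t. L (t *\<^sub>R x))) (at 0)"
      by (rule has_derivative_compose)
    then show ?thesis
      by (simp add: has_field_derivative_def linear_cmul[OF lin] mult.commute[of _ "L x"])
  qed
  have ax: "axis w t = t *\<^sub>R (axis w 1 :: real^'n)" for w t
    by (simp add: vec_eq_iff axis_def)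
  have ve: "vec t = t *\<^sub>R (\<Sum>w\<in>UNIV. axis w 1 :: real^'n)" for t
    by (simp add: vec_eq_iff axis_def)
  have eq: "L (axis w' 1) = L (axis w 1)" for w'
    using dir[of "axis w' 1"] dir[of "axis w 1"] sym[of w' _ w]
    unfolding ax[symmetric] by (simp only:) (rule DERIV_unique)
  have "real CARD('n) * D = L (\<Sum>w\<in>UNIV. axis w 1)"
    using tot dir[of "\<Sum>w\<in>UNIV. axis w 1"] unfolding ve by (rule DERIV_unique)
  also have "\<dots> = (\<Sum>w'\<in>(UNIV :: 'n set). L (axis w 1))"
    unfolding linear_sum[OF lin] by (intro sum.cong refl eq)
  finally have "D = L (axis w 1)" by simp
  then show ?thesis using dir[of "axis w 1"] by (simp add: ax[symmetric])
qed

text \<open>Every edge of direction \<open>J\<close> receives its own parameter. Translation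
  invariance makes the partial derivatives of the sum of densities equal, and on the diagonal the
  state is translation invariant, so that every vertex contributes the same density. The number of
  vertices cancels. This replaces the many vertices touched by one edge by a single vertex.\<close>

lemma single_edge_derivative:
  fixes H :: "'l::nontriv state \<Rightarrow> real"
    and dens :: "'l vertex \<Rightarrow> ('l edge \<Rightarrow> quaternion) \<Rightarrow> ('l edge \<Rightarrow> real^3) \<Rightarrow> real"
    and g0 :: "3 \<Rightarrow> quaternion" and f0 :: "3 \<Rightarrow> real^3" and w :: "'l vertex"
  assumes H: "\<And>q p. (\<And>e. norm (q e) = 1) \<Longrightarrow> (\<And>v. triple (qX q p v) > 0) \<Longrightarrow>
      H (qstate q p) = (\<Sum>v\<in>UNIV. dens v q p)"
    and dens: "\<And>v u q p. dens (v + u) q p = dens v (translate u q) (translate u p)"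
    and unit: "\<And>I. norm (g0 I) = 1" "\<And>t. norm (g t) = 1"
    and base: "g 0 = g0 J" "f 0 = f0 J"
    and diff: "g differentiable (at 0)" "f differentiable (at 0)"
    and pos: "triple (qX (\<lambda>e::'l edge. g0 (snd e)) (\<lambda>e. f0 (snd e)) 0) > 0"
    and dens_diff: "\<And>(q :: real^('l vertex) \<Rightarrow> 'l edge \<Rightarrow> quaternion) p v.
      (\<And>e. (\<lambda>x. q x e) differentiable (at 0)) \<Longrightarrow> (\<And>e. (\<lambda>x. p x e) differentiable (at 0)) \<Longrightarrow>
      q 0 = (\<lambda>e. g0 (snd e)) \<Longrightarrow> p 0 = (\<lambda>e. f0 (snd e)) \<Longrightarrow>
      (\<lambda>x. dens v (q x) (p x)) differentiable (at 0)"
    and D: "((\<lambda>t. dens 0 (\<lambda>e. (g0(J := g t)) (snd e)) (\<lambda>e. (f0(J := f t)) (snd e)))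
      has_real_derivative D) (at 0)"
  shows "((\<lambda>t. H (qstate (\<lambda>e. if e = (w, J) then g t else g0 (snd e))
      (\<lambda>e. if e = (w, J) then f t else f0 (snd e)))) has_real_derivative D) (at 0)"
proof -
  \<comment> \<open>The coordinate of \<open>x\<close> at a vertex is the parameter of the edge of
    direction \<open>J\<close> starting there.\<close>
  define q where "q x e = (if snd e = J then g (x $ fst e) else g0 (snd e))" for x :: "real^('l vertex)" and e
  define p where "p x e = (if snd e = J then f (x $ fst e) else f0 (snd e))" for x :: "real^('l vertex)" and e
  define \<phi> where "\<phi> x = (\<Sum>v\<in>UNIV. dens v (q x) (p x))" for x
  have comp: "(\<lambda>x :: real^('l vertex). h (x $ i)) differentiable (at 0)"
    if "h differentiable (at 0)" for h :: "real \<Rightarrow> 'c::real_normed_vector" and i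
  proof -
    have "(\<lambda>x :: real^('l vertex). x $ i) differentiable (at 0)"
      by (intro bounded_linear_imp_differentiable bounded_linear_vec_nth)
    then show ?thesis
      using that differentiable_chain_at[of "\<lambda>x :: real^('l vertex). x $ i" 0 h] by (simp add: o_def)
  qed
  have dq: "(\<lambda>x. q x e) differentiable (at 0)" for e
    using comp[OF diff(1)] by (cases "snd e = J") (simp_all add: q_def)
  have dp: "(\<lambda>x. p x e) differentiable (at 0)" for e
    using comp[OF diff(2)] by (cases "snd e = J") (simp_all add: p_def)
  have q0: "q 0 = (\<lambda>e. g0 (snd e))" and p0: "p 0 = (\<lambda>e. f0 (snd e))"
    using base by (auto simp: q_def p_def)
  have d\<phi>: "\<phi> differentiable (at 0)"
    unfolding \<phi>_def by (intro differentiable_sum ballI dens_diff dq dp q0 p0) auto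
  have unif: "dens v (q (vec t)) (p (vec t))
      = dens 0 (\<lambda>e. (g0(J := g t)) (snd e)) (\<lambda>e. (f0(J := f t)) (snd e))" for v t
  proof -
    have "translate v (q (vec t)) = (\<lambda>e. (g0(J := g t)) (snd e))"
      "translate v (p (vec t)) = (\<lambda>e. (f0(J := f t)) (snd e))"
      by (auto simp: translate_def q_def p_def)
    then show ?thesis using dens[of 0 v "q (vec t)" "p (vec t)"] by simp
  qed
  have sym: "\<phi> (axis w t) = \<phi> (axis w' t)" for w w' t
  proof -
    \<comment> \<open>Translations act transitively on the vertices, so any edge of direction
      \<open>J\<close> can be carried to any other; the sum over vertices is only reindexed.\<close>
    have "translate (w - w') (q (axis w t)) = q (axis w' t)" "translate (w - w') (p (axis w t)) = p (axis w' t)"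
      by (auto simp: translate_def q_def p_def axis_def algebra_simps fun_eq_iff)
    then have "\<phi> (axis w' t) = (\<Sum>v\<in>UNIV. dens (v + (w - w')) (q (axis w t)) (p (axis w t)))"
      by (simp add: \<phi>_def dens)
    also have "\<dots> = \<phi> (axis w t)"
      unfolding \<phi>_def by (rule sum.reindex_bij_witness[of _ "\<lambda>v. v - (w - w')" "\<lambda>v. v + (w - w')"]) auto
    finally show ?thesis by simp
  qed
  have "((\<lambda>t. \<phi> (vec t)) has_real_derivative (real CARD('l vertex) * D)) (at 0)"
    unfolding \<phi>_def unif sum_constant by (rule DERIV_cmult[OF D])
  from vec_derivative_axis[OF d\<phi> sym this]
  have main: "((\<lambda>t. \<phi> (axis w t)) has_real_derivative D) (at 0)" .
  \<comment> \<open>The sum of densities is known to represent \<open>H\<close> only where all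
    determinants are positive. This holds near 0 by continuity, simultaneously at the finitely many
    vertices.\<close>
  have "\<forall>\<^sub>F x in nhds 0. triple (qX (q x) (p x) v) > 0" for v
  proof -
    have "isCont (\<lambda>x. triple (qX (q x) (p x) v)) 0"
      by (intro differentiable_imp_continuous_within differentiable_triple_qX dq dp)
    then have "((\<lambda>x. triple (qX (q x) (p x) v)) \<longlongrightarrow> triple (qX (q 0) (p 0) v)) (nhds 0)"
      using tendsto_at_iff_tendsto_nhds[of "\<lambda>x. triple (qX (q x) (p x) v)" 0] by (simp add: isCont_def)
    moreover have "qX (q 0) (p 0) v = qX (\<lambda>e::'l edge. g0 (snd e)) (\<lambda>e. f0 (snd e)) 0"
      by (simp add: q0 p0 qX_def fun_eq_iff)
    ultimately show ?thesis using pos by (intro order_tendstoD) auto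
  qed
  then have "\<forall>\<^sub>F x in nhds 0. \<forall>v. triple (qX (q x) (p x) v) > 0"
    by (rule eventually_all_finite)
  moreover have "norm (q x e) = 1" for x e using unit by (simp add: q_def)
  ultimately have "\<forall>\<^sub>F x in nhds 0. H (qstate (q x) (p x)) = \<phi> x"
    by (auto elim!: eventually_mono intro!: H simp: \<phi>_def)
  moreover have "filterlim (axis w :: real \<Rightarrow> real^('l vertex)) (nhds 0) (nhds 0)"
  proof -
    have "axis w = (\<lambda>t. t *\<^sub>R (axis w 1 :: real^('l vertex)))"
      by (auto simp: vec_eq_iff axis_def)
    moreover have "((\<lambda>t. t *\<^sub>R (axis w 1 :: real^('l vertex))) \<longlongrightarrow> 0 *\<^sub>R axis w 1) (nhds 0)"
      by (rule tendsto_scaleR[OF filterlim_ident tendsto_const])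
    ultimately show ?thesis by simp
  qed
  ultimately have "\<forall>\<^sub>F t in nhds 0. H (qstate (q (axis w t)) (p (axis w t))) = \<phi> (axis w t)"
    by (rule eventually_compose_filterlim)
  with main have "((\<lambda>t. H (qstate (q (axis w t)) (p (axis w t)))) has_real_derivative D) (at 0)"
    by (subst DERIV_cong_ev[OF refl _ refl])
  moreover have "q (axis w t) = (\<lambda>e. if e = (w, J) then g t else g0 (snd e))"
    "p (axis w t) = (\<lambda>e. if e = (w, J) then f t else f0 (snd e))" for t
    using base by (auto simp: q_def p_def axis_def fun_eq_iff)
  ultimately show ?thesis by simp
qed


section \<open>Nearly isotropic states\<close>

definition uX :: "(3 \<Rightarrow> quaternion) \<Rightarrow> (3 \<Rightarrow> real^3) \<Rightarrow> 3 \<Rightarrow> real^3" where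
  "uX g f I = (1 / 2) *\<^sub>R (f I + qrot (g I) (f I))"

lemma qX_uniform: "qX (\<lambda>e. g (snd e)) (\<lambda>e. f (snd e)) v = uX g f"
  by (simp add: qX_def uX_def fun_eq_iff)

text \<open>The signed sum over the reflections of \<open>x\<close> and \<open>y\<close> keeps four
  times the part of the group commutator that is odd in \<open>x\<close> and odd in
  \<open>y\<close>.\<close>

lemma qmul_commutator_sum:
  "qmul (qmul (qmul (a, x) (b, y)) (a, - x)) (b, - y) - qmul (qmul (qmul (a, x) (b, - y)) (a, - x)) (b, y)
   + (qmul (qmul (qmul (a, - x) (b, - y)) (a, x)) (b, y) - qmul (qmul (qmul (a, - x) (b, y)) (a, x)) (b, - y))
   = (0, (8 * a * b) *\<^sub>R cross3 x y)"
  by (simp add: prod_eq_iff qmul_def cross3_simps forall_3)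

text \<open>For a translation invariant state the base points are irrelevant and each loop is a
  group commutator; reversing a direction changes the sign of its vector part.\<close>

lemma qloop_uniform_sum:
  "(\<Sum>s1\<in>{1, - 1}. \<Sum>s2\<in>{1, - 1}. of_int (s1 * s2) *\<^sub>R qloop (\<lambda>e. g (snd e)) v I s1 J s2)
   = (0, (8 * fst (g I) * fst (g J)) *\<^sub>R cross3 (snd (g I)) (snd (g J)))"
proof -
  obtain a x b y where "g I = (a, x)" "g J = (b, y)" by fastforce
  then show ?thesis
    using qmul_commutator_sum[of a x b y] by (simp add: qloop_def qhol_def qinv_def del: scaleR_Pair)
qed

lemma closed_constr_uniform:
  "closed_constr \<kappa> a \<beta> m v (\<lambda>e. g (snd e)) (\<lambda>e. f (snd e)) =
     - (4 * sqrt ((\<beta> * a\<^sup>2 / 2) ^ 3) / (3 * \<beta> * \<kappa> * a\<^sup>2)) / sqrt (triple (uX g f)) *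
     (\<Sum>I1\<in>UNIV. \<Sum>I2\<in>UNIV. \<Sum>I3\<in>UNIV. levi_civita I1 I2 I3 *
       fst (qmul (qmul m (0, (8 * fst (g I1) * fst (g I2)) *\<^sub>R cross3 (snd (g I1)) (snd (g I2))))
         (0, cofactor (uX g f) I3)))"
  unfolding closed_constr_def qloop_uniform_sum qX_uniform ..

section \<open>Isotropic states with one direction varied\<close>

definition iso_q :: "real \<Rightarrow> 3 \<Rightarrow> quaternion" where
  "iso_q \<theta> I = (cos (\<theta> / 2), axis I (sin (\<theta> / 2)))"

lemma norm_iso_q: "norm (iso_q \<theta> I) = 1"
proof -
  have "(norm (iso_q \<theta> I))\<^sup>2 = 1"
    by (simp add: norm_quaternion iso_q_def inner_axis_axis power2_eq_square[symmetric])
  then show ?thesis by (simp add: power2_eq_1_iff) (smt (verit) norm_ge_zero)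
qed

lemma qrot_axis: "norm q = 1 \<Longrightarrow> snd q = axis I t \<Longrightarrow> qrot q (axis I r) = axis I r"
proof -
  assume "norm q = 1" "snd q = axis I t"
  then have "(fst q)\<^sup>2 + t * t = 1" using norm_quaternion[of q] by (simp add: inner_axis_axis)
  then have "(fst q)\<^sup>2 = 1 - t * t" by simp
  moreover have "cross3 (axis I t) (axis I r) = 0"
    using exhaust_3[of I] by (auto simp: cross3_simps axis_def forall_3)
  moreover have "(1 - t * t - t * t) *\<^sub>R axis I r + (2 * (t * r)) *\<^sub>R axis I t = (axis I r :: real^3)"
    by (simp add: vec_eq_iff axis_def algebra_simps)
  ultimately show ?thesis
    using \<open>snd q = _\<close> by (simp add: qrot_explicit inner_axis_axis)
qed

lemma qrot_iso_q: "qrot (iso_q \<theta> I) (axis I p) = axis I p"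
  by (rule qrot_axis[OF norm_iso_q]) (simp add: iso_q_def)

lemma uX_near_isotropic:
  "uX ((iso_q \<theta>)(J := g)) ((\<lambda>I. axis I p)(J := f)) = (\<lambda>I. axis I p)(J := (1 / 2) *\<^sub>R (f + qrot g f))"
  by (simp add: uX_def fun_eq_iff qrot_iso_q)

lemma triple_near_isotropic:
  "triple ((\<lambda>I. axis I p)(J := Y)) = p\<^sup>2 * Y $ J"
  using exhaust_3[of J]
  by (auto simp: triple_def cross3_def inner_vec_def sum_3 axis_def power2_eq_square)

lemma half_angle: "cos (\<theta> / 2) * sin (\<theta> / 2) = sin \<theta> / 2" for \<theta> :: real
  using sin_double[of "\<theta> / 2"] by simp

lemma sqrt_vol_const: "a > 0 \<Longrightarrow> \<beta> > 0 \<Longrightarrow> sqrt ((\<beta> * a\<^sup>2 / 2) ^ 3) = \<beta> * a ^ 3 * sqrt (2 * \<beta>) / 4"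
proof -
  assume "a > 0" "\<beta> > 0"
  moreover have "(\<beta> * a ^ 3 * sqrt (2 * \<beta>) / 4)\<^sup>2 = (\<beta> * a\<^sup>2 / 2) ^ 3"
    using \<open>\<beta> > 0\<close> by (simp add: power_mult_distrib power_divide) (simp add: field_simps power2_eq_square power3_eq_cube numeral_eq_Suc)
  ultimately show ?thesis by (intro real_sqrt_unique) auto
qed

text \<open>The two loop planes containing \<open>J\<close> give the term linear in
  \<open>g\<close>, while the plane orthogonal to \<open>J\<close> gives the last summand. The curve
  enters only through the bracket with \<open>fst g\<close> and through \<open>Y $ J\<close>, so
  these two scalars are all that has to be differentiated later.\<close>

lemma closed_constr_near_isotropic:
  assumes "\<kappa> > 0" "a > 0" "\<beta> > 0" and Y: "Y = (1 / 2) *\<^sub>R (f + qrot g f)"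
  shows "closed_constr \<kappa> a \<beta> (1, 0) v (\<lambda>e. ((iso_q \<theta>)(J := g)) (snd e)) (\<lambda>e. ((\<lambda>I. axis I p)(J := f)) (snd e))
    = 16 * a * sqrt (2 * \<beta>) / (3 * \<kappa>) / sqrt (p\<^sup>2 * Y $ J) *
      (p * sin \<theta> / 2 * (fst g * (snd g $ J * Y $ J + snd g \<bullet> Y)) + p\<^sup>2 * (sin \<theta>)\<^sup>2 / 4)"
proof -
  define c where "c = cos (\<theta> / 2)"
  define s where "s = sin (\<theta> / 2)"
  define r where "r = fst g * (snd g $ J * Y $ J + snd g \<bullet> Y)"
  \<comment> \<open>The 16 is the 8 of the commutator sum times the two orders of a pair of
    directions. The minus sign is that of the scalar part of a product of pure quaternions, and it
    cancels the one in front of the constraint.\<close>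
  have sum: "(\<Sum>I1\<in>UNIV. \<Sum>I2\<in>UNIV. \<Sum>I3\<in>UNIV. levi_civita I1 I2 I3 *
       fst (qmul (qmul (1, 0) (0, (8 * fst (((iso_q \<theta>)(J := g)) I1) * fst (((iso_q \<theta>)(J := g)) I2)) *\<^sub>R
           cross3 (snd (((iso_q \<theta>)(J := g)) I1)) (snd (((iso_q \<theta>)(J := g)) I2))))
         (0, cofactor ((\<lambda>I. axis I p)(J := Y)) I3)))
    = - 16 * (p * (c * s) * r + p\<^sup>2 * (c * s)\<^sup>2)"
    using exhaust_3[of J]
    by (auto simp: sum_3 levi_civita_def qmul_def iso_q_def cofactor_def cross3_def inner_vec_def axis_def
        r_def c_def[symmetric] s_def[symmetric])
      (simp_all add: algebra_simps power2_eq_square)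
  have cs: "p * (c * s) * r + p\<^sup>2 * (c * s)\<^sup>2 = p * sin \<theta> / 2 * r + p\<^sup>2 * (sin \<theta>)\<^sup>2 / 4"
    by (simp add: c_def s_def half_angle power_divide)
  have "4 * sqrt ((\<beta> * a\<^sup>2 / 2) ^ 3) / (3 * \<beta> * \<kappa> * a\<^sup>2) = a * sqrt (2 * \<beta>) / (3 * \<kappa>)"
    unfolding sqrt_vol_const[OF assms(2,3)] using assms(1-3)
    by (simp add: field_simps power2_eq_square power3_eq_cube)
  then show ?thesis
    unfolding closed_constr_uniform uX_near_isotropic triple_near_isotropic Y[symmetric] sum cs r_def[symmetric]
    by (simp only:) (simp add: add_divide_distrib algebra_simps)
qed

text \<open>Both the loop vector and the cofactor vector are parallel to the third axis of each
  term, so inserting \<open>tau j\<close> leaves a triple product with two parallel entries.\<close>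

lemma closed_constr_tau_isotropic:
  "closed_constr \<kappa> a \<beta> (0, axis j 1) v (\<lambda>e. iso_q \<theta> (snd e)) (\<lambda>e. axis (snd e) p) = 0"
proof -
  have "uX (iso_q \<theta>) (\<lambda>I. axis I p) = (\<lambda>I. axis I p)"
    by (simp add: uX_def fun_eq_iff qrot_iso_q)
  then show ?thesis
    using closed_constr_uniform[of \<kappa> a \<beta> "(0, axis j 1)" v "iso_q \<theta>" "\<lambda>I. axis I p"]
    by (simp add: sum_3 levi_civita_def qmul_def iso_q_def cofactor_def cross3_def inner_vec_def axis_def)
qed


section \<open>Derivatives of the densities\<close>

definition dust_density ::
  "real \<Rightarrow> real \<Rightarrow> real \<Rightarrow> real \<Rightarrow> 'l::nontriv vertex \<Rightarrow> ('l edge \<Rightarrow> quaternion) \<Rightarrow> ('l edge \<Rightarrow> real^3) \<Rightarrow> real"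
where
  "dust_density \<kappa> a \<beta> \<alpha> v q p = sqrt \<bar>(closed_constr \<kappa> a \<beta> (1, 0) v q p)\<^sup>2
     - \<alpha> / 4 * (\<Sum>j\<in>UNIV. (closed_constr \<kappa> a \<beta> (0, axis j 1) v q p)\<^sup>2)\<bar>"

definition scalar_density ::
  "real \<Rightarrow> real \<Rightarrow> real \<Rightarrow> 'l::nontriv vertex \<Rightarrow> ('l edge \<Rightarrow> quaternion) \<Rightarrow> ('l edge \<Rightarrow> real^3) \<Rightarrow> real"
where
  "scalar_density \<kappa> a \<beta> v q p = sqrt \<bar>sqrt \<bar>(\<beta> * a\<^sup>2 / 2) ^ 3 * triple (qX q p v)\<bar>
     * closed_constr \<kappa> a \<beta> (1, 0) v q p\<bar>"

lemma H_dust_qstate: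
  assumes "\<kappa> > 0" "a > 0" "\<beta> > 0" "\<And>e. norm (q e) = 1" "\<And>v. triple (qX q p v) > 0"
  shows "H_dust \<kappa> a \<beta> \<alpha> (qstate q p) = (\<Sum>v\<in>UNIV. dust_density \<kappa> a \<beta> \<alpha> v q p)"
  using assms
  by (simp add: H_dust_def dust_density_def C_eucl_def C_diff_def quat_one quat_tau constr_qstate)

lemma H_scalar_qstate:
  assumes "\<kappa> > 0" "a > 0" "\<beta> > 0" "\<And>e. norm (q e) = 1" "\<And>v. triple (qX q p v) > 0"
  shows "H_scalar \<kappa> a \<beta> (qstate q p) = (\<Sum>v\<in>UNIV. scalar_density \<kappa> a \<beta> v q p)"
  using assms
  by (simp add: H_scalar_def scalar_density_def C_eucl_def quat_one constr_qstate volume_qstate)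

lemma axis_fun_upd: "(\<lambda>I. axis I p)(J := axis J p) = (\<lambda>I. axis I p)"
  by auto

lemma qX_isotropic: "qX (\<lambda>e. iso_q \<theta> (snd e)) (\<lambda>e. axis (snd e) p) v = (\<lambda>I. axis I p)"
  by (simp add: qX_def fun_eq_iff qrot_iso_q)

lemma triple_isotropic: "triple (\<lambda>I. axis I p) = p ^ 3"
  using triple_near_isotropic[of p 1 "axis 1 p"] by (simp add: axis_fun_upd power2_eq_square power3_eq_cube)

lemma closed_constr_isotropic:
  assumes "\<kappa> > 0" "a > 0" "\<beta> > 0"
  shows "closed_constr \<kappa> a \<beta> (1, 0) v (\<lambda>e. iso_q \<theta> (snd e)) (\<lambda>e. axis (snd e) p)
    = 16 * a * sqrt (2 * \<beta>) / (3 * \<kappa>) / sqrt (p ^ 3) * (3 / 4 * p\<^sup>2 * (sin \<theta>)\<^sup>2)"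
proof -
  have "fst (iso_q \<theta> 1) * (snd (iso_q \<theta> 1) $ 1 * axis 1 p $ (1 :: 3) + snd (iso_q \<theta> 1) \<bullet> axis 1 p) = p * sin \<theta>"
    using half_angle[of \<theta>] by (simp add: iso_q_def inner_axis_axis algebra_simps)
  moreover have "p\<^sup>2 * axis 1 p $ (1 :: 3) = p ^ 3"
    by (simp add: power2_eq_square power3_eq_cube)
  \<comment> \<open>The three loop planes contribute equally: two quarters come from the planes
    containing direction 1, one from the remaining plane.\<close>
  moreover have "p * sin \<theta> / 2 * (p * sin \<theta>) + p\<^sup>2 * (sin \<theta>)\<^sup>2 / 4 = 3 / 4 * p\<^sup>2 * (sin \<theta>)\<^sup>2"
    by (simp add: power2_eq_square)
  moreover have "axis 1 p = (1 / 2) *\<^sub>R (axis 1 p + qrot (iso_q \<theta> 1) (axis 1 p))"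
    by (simp add: qrot_iso_q)
  ultimately show ?thesis
    using closed_constr_near_isotropic[OF assms, of "axis 1 p" "axis 1 p" "iso_q \<theta> 1" v \<theta> 1 p]
    by (simp only: axis_fun_upd fun_upd_triv)
qed

lemma DERIV_sqrt_abs:
  assumes "(f has_real_derivative D) (at z)" "f z > 0"
  shows "((\<lambda>x. sqrt \<bar>f x\<bar>) has_real_derivative D / (2 * sqrt (f z))) (at z)"
proof -
  have "((\<lambda>y. sqrt \<bar>y\<bar>) has_real_derivative 1 / (2 * sqrt (f z))) (at (f z))"
  proof (subst DERIV_cong_ev[OF refl _ refl])
    show "\<forall>\<^sub>F y in nhds (f z). sqrt \<bar>y\<bar> = sqrt y"
      using assms(2) eventually_nhds_in_open[of "{0<..}" "f z"] by (auto elim: eventually_mono)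
    show "(sqrt has_real_derivative 1 / (2 * sqrt (f z))) (at (f z))"
      using DERIV_real_sqrt[OF assms(2)] by (simp add: field_simps)
  qed
  from DERIV_chain2[OF this assms(1)] show ?thesis by simp
qed

text \<open>The quotient rule applied to the closed form. The coefficient 3/4 of \<open>y\<close> is
  the isotropic value of the numerator, met when the inverse square root of the determinant is
  differentiated.\<close>

lemma near_isotropic_derivative:
  fixes g :: "real \<Rightarrow> quaternion" and f :: "real \<Rightarrow> real^3"
  assumes pos: "\<kappa> > 0" "a > 0" "\<beta> > 0" "p > 0"
    and base: "g 0 = iso_q \<theta> J" "f 0 = axis J p"
    and Y: "\<And>t. Y t = (1 / 2) *\<^sub>R (f t + qrot (g t) (f t))"
    and dR: "((\<lambda>t. fst (g t) * (snd (g t) $ J * Y t $ J + snd (g t) \<bullet> Y t)) has_real_derivative r) (at 0)"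
    and dY: "((\<lambda>t. Y t $ J) has_real_derivative y) (at 0)"
  shows "((\<lambda>t. closed_constr \<kappa> a \<beta> (1, 0) v (\<lambda>e. ((iso_q \<theta>)(J := g t)) (snd e)) (\<lambda>e. ((\<lambda>I. axis I p)(J := f t)) (snd e)))
    has_real_derivative 16 * a * sqrt (2 * \<beta>) / (3 * \<kappa>) * (sin \<theta> / (2 * sqrt p) * (r - 3 / 4 * sin \<theta> * y))) (at 0)"
proof -
  define M where "M = 16 * a * sqrt (2 * \<beta>) / (3 * \<kappa>)"
  define R where "R t = fst (g t) * (snd (g t) $ J * Y t $ J + snd (g t) \<bullet> Y t)" for t
  define T where "T t = p\<^sup>2 * Y t $ J" for t
  have Y0: "Y 0 = axis J p" by (simp add: Y base qrot_iso_q)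
  have T0: "T 0 = p ^ 3" by (simp add: T_def Y0 power2_eq_square power3_eq_cube)
  have R0: "R 0 = p * sin \<theta>"
    using half_angle[of \<theta>] by (simp add: R_def Y0 base iso_q_def inner_axis_axis algebra_simps)
  have "(T has_real_derivative p\<^sup>2 * y) (at 0)"
    unfolding T_def by (rule DERIV_cmult[OF dY])
  moreover have "T 0 > 0" using pos T0 by simp
  ultimately have dT: "((\<lambda>t. sqrt (T t)) has_real_derivative p\<^sup>2 * y / (2 * sqrt (p ^ 3))) (at 0)"
    using DERIV_chain2[OF DERIV_real_sqrt, of T 0 "p\<^sup>2 * y" UNIV] T0 by (simp add: field_simps)
  have dW: "((\<lambda>t. M * (p * sin \<theta> / 2 * R t + p\<^sup>2 * (sin \<theta>)\<^sup>2 / 4)) has_real_derivative M * (p * sin \<theta> / 2 * r)) (at 0)"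
    using dR unfolding R_def[symmetric] by (auto intro!: derivative_eq_intros)
  have s3: "sqrt (p ^ 3) = p * sqrt p" using pos by (simp add: real_sqrt_mult power3_eq_cube)
  have "sqrt (T 0) \<noteq> 0" using T0 pos by simp
  from DERIV_divide[OF dW dT this]
  have "((\<lambda>t. M * (p * sin \<theta> / 2 * R t + p\<^sup>2 * (sin \<theta>)\<^sup>2 / 4) / sqrt (T t)) has_real_derivative
      (M * (p * sin \<theta> / 2 * r) * (p * sqrt p)
        - M * (p * sin \<theta> / 2 * (p * sin \<theta>) + p\<^sup>2 * (sin \<theta>)\<^sup>2 / 4) * (p\<^sup>2 * y / (2 * (p * sqrt p))))
      / ((p * sqrt p) * (p * sqrt p))) (at 0)"
    by (simp add: T0 R0 s3)
  moreover have "(M * (p * sin \<theta> / 2 * r) * (p * sqrt p)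
        - M * (p * sin \<theta> / 2 * (p * sin \<theta>) + p\<^sup>2 * (sin \<theta>)\<^sup>2 / 4) * (p\<^sup>2 * y / (2 * (p * sqrt p))))
      / ((p * sqrt p) * (p * sqrt p)) = M * (sin \<theta> / (2 * sqrt p) * (r - 3 / 4 * sin \<theta> * y))"
  proof -
    \<comment> \<open>Writing \<open>p\<close> as a square turns the identity into one between
      rational functions.\<close>
    define u where "u = sqrt p"
    have "u > 0" "p = u * u" using pos by (simp_all add: u_def)
    then show ?thesis unfolding u_def[symmetric] by (simp add: field_simps power2_eq_square)
  qed
  ultimately show ?thesis
    unfolding closed_constr_near_isotropic[OF pos(1-3) Y] M_def[symmetric] R_def[symmetric] T_def[symmetric]
    by simp
qed

text \<open>Meant for the diffeomorphism constraints, which enter the dust Hamiltonian as squares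
  and vanish at the isotropic point.\<close>

lemma DERIV_square_zero:
  assumes "f differentiable (at z)" "f z = (0::real)"
  shows "((\<lambda>x. (f x)\<^sup>2) has_real_derivative 0) (at (z::real))"
proof -
  obtain D where "(f has_real_derivative D) (at z)"
    using assms(1) by (auto simp: real_differentiable_def)
  then show ?thesis using assms(2) by (auto intro!: derivative_eq_intros)
qed

section \<open>Variation of a single edge where \<open>sin \<theta>\<close> is nonzero\<close>

context
  fixes \<kappa> a \<beta> \<theta> p r y :: real and g :: "real \<Rightarrow> quaternion" and f Y :: "real \<Rightarrow> real^3" and J :: 3
  assumes pos: "\<kappa> > 0" "a > 0" "\<beta> > 0" "p > 0" and sin: "sin \<theta> \<noteq> 0"
    and unit: "\<And>t. norm (g t) = 1"
    and base: "g 0 = iso_q \<theta> J" "f 0 = axis J p"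
    and diff: "g differentiable (at 0)" "f differentiable (at 0)"
    and Y: "\<And>t. Y t = (1 / 2) *\<^sub>R (f t + qrot (g t) (f t))"
    and dR: "((\<lambda>t. fst (g t) * (snd (g t) $ J * Y t $ J + snd (g t) \<bullet> Y t)) has_real_derivative r) (at 0)"
    and dY: "((\<lambda>t. Y t $ J) has_real_derivative y) (at 0)"
begin

lemma curve_at_zero:
  "(\<lambda>e. ((iso_q \<theta>)(J := g 0)) (snd e)) = (\<lambda>e. iso_q \<theta> (snd e))"
  "(\<lambda>e. ((\<lambda>I. axis I p)(J := f 0)) (snd e)) = (\<lambda>e. axis (snd e) p)"
  by (auto simp: base)

lemma closed_constr_isotropic_pos:
  "closed_constr \<kappa> a \<beta> (1, 0) v (\<lambda>e. iso_q \<theta> (snd e)) (\<lambda>e. axis (snd e) p) > 0"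
  using pos sin by (simp add: closed_constr_isotropic)

text \<open>To first order the squared diffeomorphism constraints vanish, so the density varies like
  the absolute value of the Euclidean constraint, which is positive here. Both dust models thus
  share one derivative.\<close>

lemma dust_edge_derivative:
  "((\<lambda>t. H_dust \<kappa> a \<beta> \<alpha> (qstate (\<lambda>e :: 'l::nontriv edge. if e = (w, J) then g t else iso_q \<theta> (snd e))
      (\<lambda>e. if e = (w, J) then f t else axis (snd e) p)))
    has_real_derivative 16 * a * sqrt (2 * \<beta>) / (3 * \<kappa>) * (sin \<theta> / (2 * sqrt p) * (r - 3 / 4 * sin \<theta> * y))) (at 0)"
proof (rule single_edge_derivative[where dens = "dust_density \<kappa> a \<beta> \<alpha>"])
  define D where "D = 16 * a * sqrt (2 * \<beta>) / (3 * \<kappa>) * (sin \<theta> / (2 * sqrt p) * (r - 3 / 4 * sin \<theta> * y))"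
  let ?q = "\<lambda>t e. ((iso_q \<theta>)(J := g t)) (snd (e :: 'l edge))"
  let ?p = "\<lambda>t e. ((\<lambda>I. axis I p)(J := f t)) (snd (e :: 'l edge))"
  have dq: "(\<lambda>t. ?q t e) differentiable (at 0)" and dp: "(\<lambda>t. ?p t e) differentiable (at 0)" for e
    using diff by (cases "snd e = J"; simp)+
  have posX: "triple (qX (?q 0) (?p 0) v) > 0" for v
    unfolding curve_at_zero qX_isotropic triple_isotropic using pos by simp
  have dC: "((\<lambda>t. closed_constr \<kappa> a \<beta> (1, 0) 0 (?q t) (?p t)) has_real_derivative D) (at 0)"
    unfolding D_def using pos base Y dR dY by (rule near_isotropic_derivative)
  have dj: "((\<lambda>t. (closed_constr \<kappa> a \<beta> (0, axis j 1) 0 (?q t) (?p t))\<^sup>2) has_real_derivative 0) (at 0)" for j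
    by (intro DERIV_square_zero differentiable_closed_constr dq dp posX)
      (unfold curve_at_zero, rule closed_constr_tau_isotropic)
  have "((\<lambda>t. (closed_constr \<kappa> a \<beta> (1, 0) 0 (?q t) (?p t))\<^sup>2
      - \<alpha> / 4 * (\<Sum>j\<in>UNIV. (closed_constr \<kappa> a \<beta> (0, axis j 1) 0 (?q t) (?p t))\<^sup>2)) has_real_derivative
      2 * closed_constr \<kappa> a \<beta> (1, 0) (0 :: 'l vertex) (?q 0) (?p 0) * D - \<alpha> / 4 * (\<Sum>j\<in>(UNIV :: 3 set). 0)) (at 0)"
    by (rule DERIV_diff[OF _ DERIV_cmult[OF DERIV_sum[OF dj]]])
      (use DERIV_power[OF dC, of 2] in \<open>simp add: mult_ac\<close>)
  from DERIV_sqrt_abs[OF this]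
  \<comment> \<open>The chain rule for the square root of a square: twice the constraint appears in
    numerator and denominator and cancels next.\<close>
  have "((\<lambda>t. dust_density \<kappa> a \<beta> \<alpha> 0 (?q t) (?p t)) has_real_derivative
      2 * closed_constr \<kappa> a \<beta> (1, 0) (0 :: 'l vertex) (?q 0) (?p 0) * D
      / (2 * closed_constr \<kappa> a \<beta> (1, 0) (0 :: 'l vertex) (?q 0) (?p 0))) (at 0)"
    using closed_constr_isotropic_pos[of "0 :: 'l vertex"]
    unfolding dust_density_def[symmetric] curve_at_zero closed_constr_tau_isotropic
    by (simp add: less_imp_le)
  then show "((\<lambda>t. dust_density \<kappa> a \<beta> \<alpha> 0 (?q t) (?p t)) has_real_derivative
      16 * a * sqrt (2 * \<beta>) / (3 * \<kappa>) * (sin \<theta> / (2 * sqrt p) * (r - 3 / 4 * sin \<theta> * y))) (at 0)"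
    using closed_constr_isotropic_pos[of "0 :: 'l vertex"]
    unfolding curve_at_zero D_def[symmetric] by simp
next
  fix q :: "real^('l vertex) \<Rightarrow> 'l edge \<Rightarrow> quaternion" and p' :: "real^('l vertex) \<Rightarrow> 'l edge \<Rightarrow> real^3" and v :: "'l vertex"
  assume d: "\<And>e. (\<lambda>x. q x e) differentiable (at 0)" "\<And>e. (\<lambda>x. p' x e) differentiable (at 0)"
    and z: "q 0 = (\<lambda>e. iso_q \<theta> (snd e))" "p' 0 = (\<lambda>e. axis (snd e) p)"
  have "triple (qX (q 0) (p' 0) v) > 0"
    using pos by (simp add: z qX_isotropic triple_isotropic)
  note dc = differentiable_closed_constr[OF d this]
  show "(\<lambda>x. dust_density \<kappa> a \<beta> \<alpha> v (q x) (p' x)) differentiable (at 0)"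
    unfolding dust_density_def
    by (intro differentiable_sqrt_abs differentiable_diff differentiable_mult differentiable_power
        differentiable_sum ballI dc differentiable_const finite_class.finite_UNIV)
      (use closed_constr_isotropic_pos[of v] in \<open>simp add: z closed_constr_tau_isotropic\<close>)
qed (use pos unit base diff in \<open>simp_all add: H_dust_qstate dust_density_def closed_constr_translate
    norm_iso_q qX_isotropic triple_isotropic\<close>)

text \<open>The volume carries the square root of the determinant and the constraint its inverse, so
  the product \<open>W\<close> is affine in \<open>R\<close> and the derivative involves only
  \<open>r\<close>.\<close>

lemma scalar_edge_derivative:
  "((\<lambda>t. H_scalar \<kappa> a \<beta> (qstate (\<lambda>e :: 'l::nontriv edge. if e = (w, J) then g t else iso_q \<theta> (snd e))
      (\<lambda>e. if e = (w, J) then f t else axis (snd e) p)))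
    has_real_derivative a\<^sup>2 / \<kappa> * (sqrt (2 * \<kappa>) * \<beta> / 3) * sgn (sin \<theta>) * r) (at 0)"
proof (rule single_edge_derivative[where dens = "scalar_density \<kappa> a \<beta>"])
  define M where "M = 16 * a * sqrt (2 * \<beta>) / (3 * \<kappa>)"
  define K where "K = (\<beta> * a\<^sup>2 / 2) ^ 3"
  define R where "R t = fst (g t) * (snd (g t) $ J * Y t $ J + snd (g t) \<bullet> Y t)" for t
  define W where "W t = sqrt K * M * (p * sin \<theta> / 2 * R t + p\<^sup>2 * (sin \<theta>)\<^sup>2 / 4)" for t
  let ?q = "\<lambda>t e. ((iso_q \<theta>)(J := g t)) (snd (e :: 'l edge))"
  let ?p = "\<lambda>t e. ((\<lambda>I. axis I p)(J := f t)) (snd (e :: 'l edge))"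
  have Y0: "Y 0 = axis J p" by (simp add: Y base qrot_iso_q)
  have R0: "R 0 = p * sin \<theta>"
    using half_angle[of \<theta>] by (simp add: R_def Y0 base iso_q_def inner_axis_axis algebra_simps)
  have KM: "sqrt K * M = 8 * \<beta>\<^sup>2 * a ^ 4 / (3 * \<kappa>)"
    using pos by (simp add: K_def M_def sqrt_vol_const) (simp add: field_simps power2_eq_square power3_eq_cube power4_eq_xxxx)
  \<comment> \<open>The isotropic value is a perfect square; its root contains the absolute value of
    \<open>sin \<theta>\<close>, the origin of the sign factor in the result.\<close>
  have W0: "W 0 = (sqrt (2 * \<kappa>) * \<beta> * a\<^sup>2 * p * sin \<theta> / \<kappa>)\<^sup>2"
    using pos by (simp add: W_def R0 KM power_mult_distrib power_divide)
      (simp add: field_simps power2_eq_square power4_eq_xxxx)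
  have W0pos: "W 0 > 0" unfolding W0 using pos sin by simp
  have "(W has_real_derivative sqrt K * M * (p * sin \<theta> / 2 * r)) (at 0)"
    using dR unfolding W_def R_def[symmetric] by (auto intro!: derivative_eq_intros)
  from DERIV_sqrt_abs[OF this W0pos]
  have "((\<lambda>t. sqrt \<bar>W t\<bar>) has_real_derivative
      sqrt K * M * (p * sin \<theta> / 2 * r) / (2 * (sqrt (2 * \<kappa>) * \<beta> * a\<^sup>2 * p * \<bar>sin \<theta>\<bar> / \<kappa>))) (at 0)"
    using pos by (simp add: W0 abs_mult)
  moreover have "sqrt K * M * (p * sin \<theta> / 2 * r) / (2 * (sqrt (2 * \<kappa>) * \<beta> * a\<^sup>2 * p * \<bar>sin \<theta>\<bar> / \<kappa>))
      = a\<^sup>2 / \<kappa> * (sqrt (2 * \<kappa>) * \<beta> / 3) * sgn (sin \<theta>) * r"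
  proof -
    define u where "u = sqrt (2 * \<kappa>)"
    have "u > 0" "\<kappa> = u * u / 2" using pos by (simp_all add: u_def)
    then show ?thesis using pos sin unfolding KM u_def[symmetric]
      by (simp add: sgn_if abs_if) (simp add: field_simps power2_eq_square power4_eq_xxxx)
  qed
  ultimately have "((\<lambda>t. sqrt \<bar>W t\<bar>) has_real_derivative
      a\<^sup>2 / \<kappa> * (sqrt (2 * \<kappa>) * \<beta> / 3) * sgn (sin \<theta>) * r) (at 0)" by simp
  \<comment> \<open>The cancellation of the determinants needs \<open>Y t $ J\<close> to be
    positive, which holds near 0.\<close>
  moreover have "\<forall>\<^sub>F t in nhds 0. sqrt \<bar>W t\<bar> = scalar_density \<kappa> a \<beta> (0 :: 'l vertex) (?q t) (?p t)"
  proof -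
    have "isCont (\<lambda>t. Y t $ J) 0" using dY by (rule DERIV_isCont)
    then have "((\<lambda>t. Y t $ J) \<longlongrightarrow> p) (nhds 0)"
      using tendsto_at_iff_tendsto_nhds[of "\<lambda>t. Y t $ J" 0] by (simp add: isCont_def Y0)
    then have "\<forall>\<^sub>F t in nhds 0. Y t $ J > 0" using order_tendstoD(1) pos(4) by blast
    then show ?thesis
    proof eventually_elim
      case (elim t)
      have "triple (qX (?q t) (?p t) 0) = p\<^sup>2 * Y t $ J"
        unfolding qX_uniform uX_near_isotropic triple_near_isotropic Y ..
      moreover have "closed_constr \<kappa> a \<beta> (1, 0) (0 :: 'l vertex) (?q t) (?p t)
          = M / sqrt (p\<^sup>2 * Y t $ J) * (p * sin \<theta> / 2 * R t + p\<^sup>2 * (sin \<theta>)\<^sup>2 / 4)"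
        unfolding closed_constr_near_isotropic[OF pos(1-3) Y] M_def R_def ..
      moreover have "p\<^sup>2 * Y t $ J > 0" "K > 0" "Y t $ J \<noteq> 0" using elim pos by (simp_all add: K_def)
      ultimately show ?case
        by (simp add: scalar_density_def K_def[symmetric] W_def abs_of_pos real_sqrt_mult mult.assoc)
    qed
  qed
  ultimately show "((\<lambda>t. scalar_density \<kappa> a \<beta> 0 (?q t) (?p t)) has_real_derivative
      a\<^sup>2 / \<kappa> * (sqrt (2 * \<kappa>) * \<beta> / 3) * sgn (sin \<theta>) * r) (at 0)"
    by (subst (asm) DERIV_cong_ev[OF refl _ refl])
next
  fix q :: "real^('l vertex) \<Rightarrow> 'l edge \<Rightarrow> quaternion" and p' :: "real^('l vertex) \<Rightarrow> 'l edge \<Rightarrow> real^3" and v :: "'l vertex"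
  assume d: "\<And>e. (\<lambda>x. q x e) differentiable (at 0)" "\<And>e. (\<lambda>x. p' x e) differentiable (at 0)"
    and z: "q 0 = (\<lambda>e. iso_q \<theta> (snd e))" "p' 0 = (\<lambda>e. axis (snd e) p)"
  have tp: "triple (qX (q 0) (p' 0) v) > 0"
    using pos by (simp add: z qX_isotropic triple_isotropic)
  have "(\<beta> * a\<^sup>2 / 2) ^ 3 > 0" using pos by simp
  with tp show "(\<lambda>x. scalar_density \<kappa> a \<beta> v (q x) (p' x)) differentiable (at 0)"
    unfolding scalar_density_def
    by (intro differentiable_sqrt_abs differentiable_mult differentiable_closed_constr[OF d tp]
        differentiable_triple_qX d differentiable_const)
      (use closed_constr_isotropic_pos[of v] in \<open>simp_all add: z\<close>)
qed (use pos unit base diff in \<open>simp_all add: H_scalar_qstate scalar_density_def closed_constr_translate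
    qX_translate norm_iso_q qX_isotropic triple_isotropic\<close>)

end


section \<open>Reduction of the dynamics\<close>

lemma perturbed_theta:
  fixes w :: "'l::nontriv vertex"
  shows "perturbed_state \<theta> p ((\<lambda>_. 0)((w, J) := t)) (\<lambda>_. 0) (\<lambda>_. 0) (\<lambda>_. 0)
    = qstate (\<lambda>e. if e = (w, J) then iso_q (\<theta> + t) J else iso_q \<theta> (snd e))
        (\<lambda>e. if e = (w, J) then axis J p else axis (snd e) p)"
  by (auto simp: perturbed_state_def qstate_def perturbed_vec_def su2_exp_axis_quat iso_q_def fun_eq_iff)

lemma perturbed_p:
  fixes w :: "'l::nontriv vertex"
  shows "perturbed_state \<theta> p (\<lambda>_. 0) (\<lambda>_. 0) ((\<lambda>_. 0)((w, J) := t)) (\<lambda>_. 0)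
    = qstate (\<lambda>e. if e = (w, J) then iso_q \<theta> J else iso_q \<theta> (snd e))
        (\<lambda>e. if e = (w, J) then axis J (p + t) else axis (snd e) p)"
  by (auto simp: perturbed_state_def qstate_def perturbed_vec_def su2_exp_axis_quat iso_q_def fun_eq_iff)

lemma perturbed_p_perp:
  fixes w :: "'l::nontriv vertex"
  shows "perturbed_state \<theta> p (\<lambda>_. 0) (\<lambda>_. 0) (\<lambda>_. 0) ((\<lambda>_. 0)((w, J) := axis b t))
    = qstate (\<lambda>e. if e = (w, J) then iso_q \<theta> J else iso_q \<theta> (snd e))
        (\<lambda>e. if e = (w, J) then axis J p + axis b t else axis (snd e) p)"
  by (auto simp: perturbed_state_def qstate_def perturbed_vec_def su2_exp_axis_quat iso_q_def fun_eq_iff)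

definition exp_q :: "real^3 \<Rightarrow> quaternion" where
  "exp_q x = (cos (norm x / 2), (sin (norm x / 2) / norm x) *\<^sub>R x)"

lemma perturbed_theta_perp:
  fixes w :: "'l::nontriv vertex"
  assumes "\<theta> \<noteq> 0" "b \<noteq> J"
  shows "perturbed_state \<theta> p (\<lambda>_. 0) ((\<lambda>_. 0)((w, J) := axis b t)) (\<lambda>_. 0) (\<lambda>_. 0)
    = qstate (\<lambda>e. if e = (w, J) then exp_q (axis J \<theta> + axis b t) else iso_q \<theta> (snd e))
        (\<lambda>e. if e = (w, J) then axis J p else axis (snd e) p)"
proof -
  have "(axis J \<theta> + axis b t) $ J = \<theta>" using assms by (simp add: axis_def)
  then have "axis J \<theta> + axis b t \<noteq> 0" using assms by (metis zero_index)
  then show ?thesis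
    by (auto simp: perturbed_state_def qstate_def perturbed_vec_def su2_exp_axis_quat su2_exp_quat
        exp_q_def iso_q_def fun_eq_iff)
qed

lemma linear_axis: "linear (axis i :: real \<Rightarrow> real^'n)"
  by (rule linearI) (simp_all add: vec_eq_iff axis_def)

lemma differentiable_iso_q: "(\<lambda>t. iso_q (\<theta> + t) J) differentiable (at 0)"
  unfolding iso_q_def
  by (intro differentiable_Pair differentiable_linear[OF linear_axis])
    (auto simp: real_differentiable_def intro!: exI derivative_eq_intros)

lemma differentiable_axis_shift: "(\<lambda>t. axis J (p + t) :: real^3) differentiable (at 0)"
  by (intro differentiable_linear[OF linear_axis] differentiable_add) auto

lemma differentiable_axis_add: "(\<lambda>t. axis J p + axis b t :: real^3) differentiable (at 0)"
  by (intro differentiable_add differentiable_linear[OF linear_axis]) auto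

lemma qrot_iso_q_component: "qrot (iso_q \<theta> J) x $ J = x $ J"
proof -
  have "cross3 (axis J s) x $ J = 0" for s
    using exhaust_3[of J] by (auto simp: cross3_def axis_def)
  moreover have "x $ J * (cos (\<theta> / 2) * cos (\<theta> / 2)) + x $ J * (sin (\<theta> / 2) * sin (\<theta> / 2)) = x $ J"
    by (simp only: distrib_left[symmetric] power2_eq_square[symmetric] sin_cos_squared_add2 mult_1_right)
  ultimately show ?thesis
    by (simp add: qrot_explicit iso_q_def inner_axis_axis inner_axis' power2_eq_square algebra_simps)
qed

text \<open>The rotation by \<open>q\<close> fixes the vector part of \<open>q\<close>, so the inner
  product with it is the same for the rotated flux; the other identity is Rodrigues' formula with
  the norm condition inserted.\<close>

lemma flux_mean_axis:
  assumes "norm q = 1" and Y: "Y = (1 / 2) *\<^sub>R (axis J p + qrot q (axis J p))"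
  shows "Y $ J = p * ((fst q)\<^sup>2 + (snd q $ J)\<^sup>2)" "snd q \<bullet> Y = p * snd q $ J"
proof -
  have n: "snd q \<bullet> snd q = 1 - (fst q)\<^sup>2" using assms(1) norm_quaternion[of q] by simp
  have "cross3 (snd q) (axis J p) $ J = 0"
    using exhaust_3[of J] by (auto simp: cross3_def axis_def)
  then show "Y $ J = p * ((fst q)\<^sup>2 + (snd q $ J)\<^sup>2)"
    by (simp add: Y qrot_explicit n inner_axis power2_eq_square algebra_simps)
  show "snd q \<bullet> Y = p * snd q $ J"
    by (simp add: Y qrot_explicit n inner_axis inner_add_right inner_diff_right dot_cross_self algebra_simps)
qed

text \<open>Both Hamiltonians supply the premise with their own \<open>D\<close>, so only the rates
  \<open>r\<close> and \<open>y\<close> of the four curves remain. Parallel perturbations turn the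
  bracket into \<open>sin \<theta>\<close> times the flux with one of them varied. For perpendicular
  fluxes both scalars are constant, and for perpendicular angles both are even in
  \<open>t\<close>.\<close>

lemma edge_derivative_cases:
  fixes H :: "'l::nontriv state \<Rightarrow> real" and D :: "real \<Rightarrow> real \<Rightarrow> real"
  assumes edge: "\<And>(g :: real \<Rightarrow> quaternion) f Y J r y (w :: 'l vertex).
      (\<And>t. norm (g t) = 1) \<Longrightarrow> g 0 = iso_q \<theta> J \<Longrightarrow> f 0 = axis J p \<Longrightarrow>
      g differentiable (at 0) \<Longrightarrow> f differentiable (at 0) \<Longrightarrow>
      (\<And>t. Y t = (1 / 2) *\<^sub>R (f t + qrot (g t) (f t))) \<Longrightarrow>
      ((\<lambda>t. fst (g t) * (snd (g t) $ J * Y t $ J + snd (g t) \<bullet> Y t)) has_real_derivative r) (at 0) \<Longrightarrow>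
      ((\<lambda>t. Y t $ J) has_real_derivative y) (at 0) \<Longrightarrow>
      ((\<lambda>t. H (qstate (\<lambda>e. if e = (w, J) then g t else iso_q \<theta> (snd e))
        (\<lambda>e. if e = (w, J) then f t else axis (snd e) p))) has_real_derivative D r y) (at 0)"
    and "sin \<theta> \<noteq> 0"
  shows "(along_theta_par H \<theta> p (w, J) has_real_derivative D (p * cos \<theta>) 0) (at 0)"
    and "(along_p_par H \<theta> p (w, J) has_real_derivative D (sin \<theta>) 1) (at 0)"
    and "b \<noteq> J \<Longrightarrow> (along_theta_perp H \<theta> p (w, J) b has_real_derivative D 0 0) (at 0)"
    and "b \<noteq> J \<Longrightarrow> (along_p_perp H \<theta> p (w, J) b has_real_derivative D 0 0) (at 0)"
proof -
  have iso: "fst (iso_q \<theta>' J) * (snd (iso_q \<theta>' J) $ J * x $ J + snd (iso_q \<theta>' J) \<bullet> x) = sin \<theta>' * x $ J"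
    for \<theta>' and x :: "real^3"
    using half_angle[of \<theta>'] by (simp add: iso_q_def inner_axis' algebra_simps)
  show "(along_theta_par H \<theta> p (w, J) has_real_derivative D (p * cos \<theta>) 0) (at 0)"
    unfolding along_theta_par_def[abs_def] perturbed_theta
    by (rule edge[where Y = "\<lambda>_. axis J p"])
      ((unfold iso qrot_iso_q)?, auto simp: norm_iso_q differentiable_iso_q intro!: derivative_eq_intros)+
  show "(along_p_par H \<theta> p (w, J) has_real_derivative D (sin \<theta>) 1) (at 0)"
    unfolding along_p_par_def[abs_def] perturbed_p
    by (rule edge[where Y = "\<lambda>t. axis J (p + t)"])
      ((unfold iso qrot_iso_q)?, auto simp: norm_iso_q differentiable_axis_shift intro!: derivative_eq_intros)+
  assume "b \<noteq> J"
  then have "(axis J p + axis b t) $ J = p" for t by (simp add: axis_def)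
  then have "((1 / 2) *\<^sub>R (axis J p + axis b t + qrot (iso_q \<theta> J) (axis J p + axis b t))) $ J = p" for t
    by (simp only: vector_scaleR_component vector_add_component[of _ "qrot _ _"] qrot_iso_q_component) simp
  then show "(along_p_perp H \<theta> p (w, J) b has_real_derivative D 0 0) (at 0)"
    unfolding along_p_perp_def[abs_def] perturbed_p_perp
    by (intro edge[where Y = "\<lambda>t. (1 / 2) *\<^sub>R (axis J p + axis b t + qrot (iso_q \<theta> J) (axis J p + axis b t))"],
        unfold iso) (simp_all only: norm_iso_q differentiable_axis_add linear_0[OF linear_axis]
          DERIV_const differentiable_const add_0_right)
  have \<theta>: "\<theta> \<noteq> 0" using \<open>sin \<theta> \<noteq> 0\<close> by auto
  \<comment> \<open>The length of the rotation vector is even in \<open>t\<close> and nonzero, so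
    \<open>A\<close>, \<open>B\<close> and with them the bracket and \<open>Y t $ J\<close> have
    derivative 0 at 0.\<close>
  define R where "R t = sqrt (\<theta>\<^sup>2 + t\<^sup>2)" for t
  define A where "A t = cos (R t / 2)" for t
  define B where "B t = sin (R t / 2) / R t * \<theta>" for t
  define g where "g t = exp_q (axis J \<theta> + axis b t)" for t
  have norm_R: "norm (axis J \<theta> + axis b t) = R t" for t
  proof -
    have "(norm (axis J \<theta> + axis b t))\<^sup>2 = \<theta>\<^sup>2 + t\<^sup>2"
      using \<open>b \<noteq> J\<close> unfolding power2_norm_eq_inner
      by (simp add: inner_add_left inner_add_right inner_axis_axis power2_eq_square)
    then show ?thesis unfolding R_def by (metis norm_ge_zero real_sqrt_unique)
  qed
  have R_pos: "R t > 0" for t using \<theta> by (simp add: R_def sum_power2_gt_zero_iff)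
  have dR: "(R has_real_derivative 0) (at 0)"
    unfolding R_def using \<theta> by (auto intro!: derivative_eq_intros)
  have dA: "(A has_real_derivative 0) (at 0)"
    unfolding A_def by (rule derivative_eq_intros dR refl | simp)+
  have dS: "((\<lambda>t. sin (R t / 2) / R t) has_real_derivative 0) (at 0)"
    using less_imp_neq[OF R_pos[of 0]] by - (rule dR derivative_eq_intros refl | simp)+
  have dB: "(B has_real_derivative 0) (at 0)"
    unfolding B_def using DERIV_cmult_right[OF dS, of \<theta>] by simp
  have g: "g t = (A t, (sin (R t / 2) / R t) *\<^sub>R (axis J \<theta> + axis b t))" for t
    by (simp add: g_def exp_q_def norm_R A_def)
  have g1: "norm (g t) = 1" for t
  proof -
    have "(norm (g t))\<^sup>2 = (cos (R t / 2))\<^sup>2 + (sin (R t / 2) / R t)\<^sup>2 * (norm (axis J \<theta> + axis b t))\<^sup>2"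
      unfolding norm_quaternion power2_norm_eq_inner by (simp add: g A_def power2_eq_square)
    also have "\<dots> = 1"
      using R_pos[of t] by (simp add: norm_R power_divide)
    finally show ?thesis by (simp add: power2_eq_1_iff) (smt (verit) norm_ge_zero)
  qed
  have gB: "snd (g t) $ J = B t" for t
    using \<open>b \<noteq> J\<close> by (simp add: g B_def axis_def)
  have g0: "g 0 = iso_q \<theta> J"
  proof -
    have "c *\<^sub>R axis J \<theta> = (axis J (c * \<theta>) :: real^3)" for c
      by (simp add: vec_eq_iff axis_def)
    then have "g 0 = (cos (\<bar>\<theta>\<bar> / 2), axis J (sin (\<bar>\<theta>\<bar> / 2) / \<bar>\<theta>\<bar> * \<theta>))"
      by (simp add: g A_def R_def linear_0[OF linear_axis])
    \<comment> \<open>The length at \<open>t = 0\<close> is the absolute value of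
      \<open>\<theta>\<close>; since cosine is even and sine is odd, its sign cancels.\<close>
    then show ?thesis using \<theta> by (cases "\<theta> < 0") (simp_all add: iso_q_def)
  qed
  have dg: "g differentiable (at 0)"
    unfolding g
  proof (intro differentiable_Pair differentiable_scaleR differentiable_axis_add)
    show "A differentiable (at 0)" "(\<lambda>t. sin (R t / 2) / R t) differentiable (at 0)"
      using dA dS by (auto simp: real_differentiable_def)
  qed
  define Y where "Y t = (1 / 2) *\<^sub>R (axis J p + qrot (g t) (axis J p))" for t
  have YJ: "Y t $ J = p * ((A t)\<^sup>2 + (B t)\<^sup>2)" and gY: "snd (g t) \<bullet> Y t = p * B t" for t
    using flux_mean_axis[OF g1 Y_def, of t] by (simp_all only: gB) (simp_all add: g)
  show "(along_theta_perp H \<theta> p (w, J) b has_real_derivative D 0 0) (at 0)"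
    unfolding along_theta_perp_def[abs_def] perturbed_theta_perp[OF \<theta> \<open>b \<noteq> J\<close>] g_def[symmetric]
  proof (rule edge[where Y = Y])
    show "((\<lambda>t. Y t $ J) has_real_derivative 0) (at 0)"
      unfolding YJ by (rule derivative_eq_intros dA dB refl | simp)+
    have "fst (g t) = A t" for t by (simp add: g)
    then show "((\<lambda>t. fst (g t) * (snd (g t) $ J * Y t $ J + snd (g t) \<bullet> Y t)) has_real_derivative 0) (at 0)"
      unfolding YJ gB gY by simp (rule derivative_eq_intros dA dB refl | simp)+
  qed (simp_all add: g1 g0 dg Y_def)
qed

lemma zero_fun_upd: "(\<lambda>_. 0)(e := 0) = (\<lambda>_. 0)"
  by auto

lemma DERIV_nonneg_zero:
  fixes F :: "real \<Rightarrow> real"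
  assumes "(F has_real_derivative D) (at z)" "\<And>t. F t \<ge> 0" "F z = 0"
  shows "D = 0"
  using assms(1) by (rule DERIV_local_min[of _ _ _ 1]) (use assms in auto)

text \<open>Where \<open>sin \<theta>\<close> is nonzero the derivatives of \<open>H\<close> are
  those of \<open>G\<close> up to the factor that the evolution equations cancel. Where it vanishes,
  \<open>H\<close> and \<open>G\<close> sit at their minimum 0, so every derivative that exists is 0
  on both sides and the equations again coincide.\<close>

lemma reduced_dynamics:
  fixes H :: "'l::nontriv state \<Rightarrow> real" and G :: "real \<Rightarrow> real \<Rightarrow> real"
  assumes pos: "\<kappa> > 0" "a > 0" "\<forall>\<tau>\<in>T. p \<tau> > 0"
    and H_nonneg: "\<And>x. H x \<ge> 0"
    and H_zero: "\<And>\<theta> p. sin \<theta> = 0 \<Longrightarrow> p > 0 \<Longrightarrow> H (qstate (\<lambda>e. iso_q \<theta> (snd e)) (\<lambda>e. axis (snd e) p)) = 0"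
    and G_nonneg: "\<And>\<theta> p. p > 0 \<Longrightarrow> G \<theta> p \<ge> 0"
    and G_zero: "\<And>\<theta> p. sin \<theta> = 0 \<Longrightarrow> G \<theta> p = 0"
    and dGp: "\<And>\<theta> p. sin \<theta> \<noteq> 0 \<Longrightarrow> p > 0 \<Longrightarrow> ((\<lambda>q. G \<theta> q) has_real_derivative Gp \<theta> p) (at p)"
    and dGt: "\<And>\<theta> p. sin \<theta> \<noteq> 0 \<Longrightarrow> p > 0 \<Longrightarrow> ((\<lambda>u. G u p) has_real_derivative Gt \<theta> p) (at \<theta>)"
    and dHp: "\<And>\<theta> p w J. sin \<theta> \<noteq> 0 \<Longrightarrow> p > 0 \<Longrightarrow>
      (along_p_par H \<theta> p (w, J) has_real_derivative a\<^sup>2 / \<kappa> * Gp \<theta> p) (at 0)"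
    and dHt: "\<And>\<theta> p w J. sin \<theta> \<noteq> 0 \<Longrightarrow> p > 0 \<Longrightarrow>
      (along_theta_par H \<theta> p (w, J) has_real_derivative a\<^sup>2 / \<kappa> * Gt \<theta> p) (at 0)"
    and dHp_perp: "\<And>\<theta> p w J b. sin \<theta> \<noteq> 0 \<Longrightarrow> p > 0 \<Longrightarrow> b \<noteq> J \<Longrightarrow>
      (along_p_perp H \<theta> p (w, J) b has_real_derivative 0) (at 0)"
    and dHt_perp: "\<And>\<theta> p w J b. sin \<theta> \<noteq> 0 \<Longrightarrow> p > 0 \<Longrightarrow> b \<noteq> J \<Longrightarrow>
      (along_theta_perp H \<theta> p (w, J) b has_real_derivative 0) (at 0)"
  shows "(\<forall>\<tau>\<in>T. sin (\<theta> \<tau>) \<noteq> 0 \<longrightarrow>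
             evolution_derivs_exist H (\<theta> \<tau>) (p \<tau>) \<and> hamilton_derivs_exist G (\<theta> \<tau>) (p \<tau>)) \<and>
          ((\<forall>\<tau>\<in>T. evolution_derivs_exist H (\<theta> \<tau>) (p \<tau>) \<and>
                  hamilton_derivs_exist G (\<theta> \<tau>) (p \<tau>)) \<longrightarrow>
             (evolution_eqs \<kappa> a H \<theta> p T \<longleftrightarrow> hamilton_eqs G \<theta> p T)) \<and>
          (\<forall>\<tau>\<in>T. sin (\<theta> \<tau>) \<noteq> 0 \<longrightarrow> constraint_eqs H (\<theta> \<tau>) (p \<tau>)) \<and>
          (\<forall>\<tau>\<in>T. constraint_eqs_where_defined H (\<theta> \<tau>) (p \<tau>))"
proof (intro conjI)
  show "\<forall>\<tau>\<in>T. sin (\<theta> \<tau>) \<noteq> 0 \<longrightarrow>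
      evolution_derivs_exist H (\<theta> \<tau>) (p \<tau>) \<and> hamilton_derivs_exist G (\<theta> \<tau>) (p \<tau>)"
    using pos dGp dGt dHp dHt
    unfolding evolution_derivs_exist_def hamilton_derivs_exist_def real_differentiable_def by blast
  show constr: "\<forall>\<tau>\<in>T. sin (\<theta> \<tau>) \<noteq> 0 \<longrightarrow> constraint_eqs H (\<theta> \<tau>) (p \<tau>)"
    using pos dHp_perp dHt_perp unfolding constraint_eqs_def by blast
  have unperturbed: "along_p_par H u q (w, J) 0 = 0" "along_theta_par H u q (w, J) 0 = 0"
    "along_p_perp H u q (w, J) b 0 = 0" "along_theta_perp H u q (w, J) b 0 = 0"
    if "sin u = 0" "q > 0" for u q w J b
  proof -
    have "perturbed_state u q (\<lambda>_. 0) (\<lambda>_. 0) (\<lambda>_. 0) (\<lambda>_. 0)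
        = qstate (\<lambda>e :: 'l edge. iso_q u (snd e)) (\<lambda>e. axis (snd e) q)"
      by (simp add: perturbed_state_def qstate_def perturbed_vec_def su2_exp_axis_quat iso_q_def fun_eq_iff)
    then show "along_p_par H u q (w, J) 0 = 0" "along_theta_par H u q (w, J) 0 = 0"
      "along_p_perp H u q (w, J) b 0 = 0" "along_theta_perp H u q (w, J) b 0 = 0"
      using H_zero[OF that]
      by (simp_all add: along_p_par_def along_theta_par_def along_p_perp_def along_theta_perp_def
          zero_fun_upd linear_0[OF linear_axis])
  qed
  have along_nonneg: "along_p_par H u q e t \<ge> 0" "along_theta_par H u q e t \<ge> 0"
    "along_p_perp H u q e b t \<ge> 0" "along_theta_perp H u q e b t \<ge> 0" for u q e b t
    by (simp_all add: along_p_par_def along_theta_par_def along_p_perp_def along_theta_perp_def H_nonneg)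
  show "\<forall>\<tau>\<in>T. constraint_eqs_where_defined H (\<theta> \<tau>) (p \<tau>)"
  proof
    fix \<tau> assume \<tau>: "\<tau> \<in> T"
    show "constraint_eqs_where_defined H (\<theta> \<tau>) (p \<tau>)"
    proof (cases "sin (\<theta> \<tau>) = 0")
      case True
      then show ?thesis
        using pos \<tau> unfolding constraint_eqs_where_defined_def
        by (auto dest!: DERIV_nonneg_zero[OF _ along_nonneg(3)] DERIV_nonneg_zero[OF _ along_nonneg(4)]
            simp: unperturbed)
    next
      case False
      then show ?thesis
        using constr \<tau> unfolding constraint_eqs_def constraint_eqs_where_defined_def
        by (meson DERIV_unique)
    qed
  qed
  show "(\<forall>\<tau>\<in>T. evolution_derivs_exist H (\<theta> \<tau>) (p \<tau>) \<and> hamilton_derivs_exist G (\<theta> \<tau>) (p \<tau>)) \<longrightarrow>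
      (evolution_eqs \<kappa> a H \<theta> p T \<longleftrightarrow> hamilton_eqs G \<theta> p T)"
  proof
    assume ex: "\<forall>\<tau>\<in>T. evolution_derivs_exist H (\<theta> \<tau>) (p \<tau>) \<and> hamilton_derivs_exist G (\<theta> \<tau>) (p \<tau>)"
    have "\<kappa> / a\<^sup>2 * deriv (along_p_par H (\<theta> \<tau>) (p \<tau>) (w, J)) 0 = deriv (\<lambda>q. G (\<theta> \<tau>) q) (p \<tau>) \<and>
        \<kappa> / a\<^sup>2 * deriv (along_theta_par H (\<theta> \<tau>) (p \<tau>) (w, J)) 0 = deriv (\<lambda>u. G u (p \<tau>)) (\<theta> \<tau>)"
      if \<tau>: "\<tau> \<in> T" for \<tau> w J
    proof (cases "sin (\<theta> \<tau>) = 0")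
      case False
      then show ?thesis
        using pos \<tau> DERIV_imp_deriv[OF dGp] DERIV_imp_deriv[OF dGt] DERIV_imp_deriv[OF dHp] DERIV_imp_deriv[OF dHt]
        by simp
    next
      case True
      have q: "p \<tau> > 0" using pos \<tau> by blast
      have "(along_p_par H (\<theta> \<tau>) (p \<tau>) (w, J) has_real_derivative deriv (along_p_par H (\<theta> \<tau>) (p \<tau>) (w, J)) 0) (at 0)"
        "(along_theta_par H (\<theta> \<tau>) (p \<tau>) (w, J) has_real_derivative deriv (along_theta_par H (\<theta> \<tau>) (p \<tau>) (w, J)) 0) (at 0)"
        "((\<lambda>u. G u (p \<tau>)) has_real_derivative deriv (\<lambda>u. G u (p \<tau>)) (\<theta> \<tau>)) (at (\<theta> \<tau>))"
        using ex \<tau> unfolding evolution_derivs_exist_def hamilton_derivs_exist_def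
        by (simp_all add: DERIV_deriv_iff_real_differentiable)
      then have "deriv (along_p_par H (\<theta> \<tau>) (p \<tau>) (w, J)) 0 = 0"
        "deriv (along_theta_par H (\<theta> \<tau>) (p \<tau>) (w, J)) 0 = 0" "deriv (\<lambda>u. G u (p \<tau>)) (\<theta> \<tau>) = 0"
        using True q by (auto elim!: DERIV_nonneg_zero simp: along_nonneg unperturbed G_nonneg G_zero)
      \<comment> \<open>Here \<open>G\<close> vanishes identically in its second argument, so the
        derivative in \<open>p\<close> is that of a constant function.\<close>
      moreover have "deriv (\<lambda>q. G (\<theta> \<tau>) q) (p \<tau>) = 0" using True by (simp add: G_zero)
      ultimately show ?thesis by simp
    qed
    then show "evolution_eqs \<kappa> a H \<theta> p T \<longleftrightarrow> hamilton_eqs G \<theta> p T"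
      unfolding evolution_eqs_def hamilton_eqs_def by (simp add: mult_minus_left)
  qed
qed

section \<open>Minima of the Hamiltonians and the two models\<close>

lemma H_dust_nonneg: "H_dust \<kappa> a \<beta> \<alpha> x \<ge> 0"
  and H_scalar_nonneg: "H_scalar \<kappa> a \<beta> x \<ge> 0"
  by (simp_all add: H_dust_def H_scalar_def sum_nonneg)

lemma H_dust_isotropic_zero:
  assumes "\<kappa> > 0" "a > 0" "\<beta> > 0" "p > 0" "sin \<theta> = 0"
  shows "H_dust \<kappa> a \<beta> \<alpha> (qstate (\<lambda>e :: 'l::nontriv edge. iso_q \<theta> (snd e)) (\<lambda>e. axis (snd e) p)) = 0"
  using assms
  by (simp add: H_dust_qstate norm_iso_q qX_isotropic triple_isotropic dust_density_def
      closed_constr_isotropic closed_constr_tau_isotropic)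

lemma H_scalar_isotropic_zero:
  assumes "\<kappa> > 0" "a > 0" "\<beta> > 0" "p > 0" "sin \<theta> = 0"
  shows "H_scalar \<kappa> a \<beta> (qstate (\<lambda>e :: 'l::nontriv edge. iso_q \<theta> (snd e)) (\<lambda>e. axis (snd e) p)) = 0"
  using assms
  by (simp add: H_scalar_qstate norm_iso_q qX_isotropic triple_isotropic scalar_density_def
      closed_constr_isotropic)

theorem theorem6p1:
  fixes \<kappa> a \<beta> :: real
    and \<theta> p :: "real \<Rightarrow> real" and T :: "real set"
  assumes "\<kappa> > 0" and "a > 0" and "\<beta> > 0"
    and "\<forall>\<tau>\<in>T. p \<tau> > 0"
  shows
    "(\<forall>\<alpha>\<in>{0, 1}.
       let H = (H_dust \<kappa> a \<beta> \<alpha> :: 'l::nontriv state \<Rightarrow> real);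
           G = (\<lambda>\<theta> p. 4 / (3 * a) * sqrt (2 * \<beta> * p) * (sin \<theta>)\<^sup>2)
       in (\<forall>\<tau>\<in>T. sin (\<theta> \<tau>) \<noteq> 0 \<longrightarrow>
             evolution_derivs_exist H (\<theta> \<tau>) (p \<tau>) \<and> hamilton_derivs_exist G (\<theta> \<tau>) (p \<tau>)) \<and>
          ((\<forall>\<tau>\<in>T. evolution_derivs_exist H (\<theta> \<tau>) (p \<tau>) \<and>
                  hamilton_derivs_exist G (\<theta> \<tau>) (p \<tau>)) \<longrightarrow>
             (evolution_eqs \<kappa> a H \<theta> p T \<longleftrightarrow> hamilton_eqs G \<theta> p T)) \<and>
          (\<forall>\<tau>\<in>T. sin (\<theta> \<tau>) \<noteq> 0 \<longrightarrow> constraint_eqs H (\<theta> \<tau>) (p \<tau>)) \<and>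
          (\<forall>\<tau>\<in>T. constraint_eqs_where_defined H (\<theta> \<tau>) (p \<tau>)))
     \<and>
     (let H = (H_scalar \<kappa> a \<beta> :: 'l state \<Rightarrow> real);
          G = (\<lambda>\<theta> p. sqrt (2 * \<kappa>) * \<beta> * p / 3 * sqrt ((sin \<theta>)\<^sup>2))
      in (\<forall>\<tau>\<in>T. sin (\<theta> \<tau>) \<noteq> 0 \<longrightarrow>
            evolution_derivs_exist H (\<theta> \<tau>) (p \<tau>) \<and> hamilton_derivs_exist G (\<theta> \<tau>) (p \<tau>)) \<and>
         ((\<forall>\<tau>\<in>T. evolution_derivs_exist H (\<theta> \<tau>) (p \<tau>) \<and>
                 hamilton_derivs_exist G (\<theta> \<tau>) (p \<tau>)) \<longrightarrow>
            (evolution_eqs \<kappa> a H \<theta> p T \<longleftrightarrow> hamilton_eqs G \<theta> p T)) \<and>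
         (\<forall>\<tau>\<in>T. sin (\<theta> \<tau>) \<noteq> 0 \<longrightarrow> constraint_eqs H (\<theta> \<tau>) (p \<tau>)) \<and>
         (\<forall>\<tau>\<in>T. constraint_eqs_where_defined H (\<theta> \<tau>) (p \<tau>)))"
  unfolding Let_def
proof (rule conjI, rule ballI)
  fix \<alpha> :: real
  define D where "D \<theta> p r y = 16 * a * sqrt (2 * \<beta>) / (3 * \<kappa>)
    * (sin \<theta> / (2 * sqrt p) * (r - 3 / 4 * sin \<theta> * y))" for \<theta> p r y
  have edge: "sin u \<noteq> 0 \<Longrightarrow> q > 0 \<Longrightarrow>
      (along_theta_par (H_dust \<kappa> a \<beta> \<alpha>) u q (w :: 'l vertex, J) has_real_derivative D u q (q * cos u) 0) (at 0)"
    "sin u \<noteq> 0 \<Longrightarrow> q > 0 \<Longrightarrow>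
      (along_p_par (H_dust \<kappa> a \<beta> \<alpha>) u q (w, J) has_real_derivative D u q (sin u) 1) (at 0)"
    "sin u \<noteq> 0 \<Longrightarrow> q > 0 \<Longrightarrow> b \<noteq> J \<Longrightarrow>
      (along_theta_perp (H_dust \<kappa> a \<beta> \<alpha>) u q (w, J) b has_real_derivative D u q 0 0) (at 0)"
    "sin u \<noteq> 0 \<Longrightarrow> q > 0 \<Longrightarrow> b \<noteq> J \<Longrightarrow>
      (along_p_perp (H_dust \<kappa> a \<beta> \<alpha>) u q (w, J) b has_real_derivative D u q 0 0) (at 0)"
    for u q w J b
    by (rule edge_derivative_cases; use dust_edge_derivative[OF assms(1-3), folded D_def] in blast)+
  \<comment> \<open>With \<open>r = sin u\<close> and \<open>y = 1\<close> the bracket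
    \<open>r - 3 / 4 * sin u * y\<close> is a quarter of \<open>sin u\<close>.\<close>
  have Dp: "D u q (sin u) 1 = a\<^sup>2 / \<kappa> * (4 / (3 * a) * (sqrt (2 * \<beta>) / (2 * sqrt q)) * (sin u)\<^sup>2)" for u q
    using assms by (simp add: D_def field_simps power2_eq_square)
  have Dt: "D u q (q * cos u) 0 = a\<^sup>2 / \<kappa> * (4 / (3 * a) * sqrt (2 * \<beta> * q) * (2 * sin u * cos u))"
    if "q > 0" for u q
  proof -
    define s where "s = sqrt q"
    have "s > 0" "q = s * s" using that by (simp_all add: s_def)
    then have "D u q (q * cos u) 0 = 8 * a * sqrt (2 * \<beta>) / (3 * \<kappa>) * sqrt q * (sin u * cos u)"
      unfolding D_def s_def[symmetric] by (simp add: field_simps)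
    then show ?thesis using assms by (simp add: real_sqrt_mult field_simps power2_eq_square)
  qed
  have D0: "D u q 0 0 = 0" for u q by (simp add: D_def)
  show "(\<forall>\<tau>\<in>T. sin (\<theta> \<tau>) \<noteq> 0 \<longrightarrow>
             evolution_derivs_exist (H_dust \<kappa> a \<beta> \<alpha> :: 'l state \<Rightarrow> real) (\<theta> \<tau>) (p \<tau>) \<and>
             hamilton_derivs_exist (\<lambda>\<theta> p. 4 / (3 * a) * sqrt (2 * \<beta> * p) * (sin \<theta>)\<^sup>2) (\<theta> \<tau>) (p \<tau>)) \<and>
          ((\<forall>\<tau>\<in>T. evolution_derivs_exist (H_dust \<kappa> a \<beta> \<alpha> :: 'l state \<Rightarrow> real) (\<theta> \<tau>) (p \<tau>) \<and>
                  hamilton_derivs_exist (\<lambda>\<theta> p. 4 / (3 * a) * sqrt (2 * \<beta> * p) * (sin \<theta>)\<^sup>2) (\<theta> \<tau>) (p \<tau>)) \<longrightarrow>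
             (evolution_eqs \<kappa> a (H_dust \<kappa> a \<beta> \<alpha> :: 'l state \<Rightarrow> real) \<theta> p T \<longleftrightarrow>
              hamilton_eqs (\<lambda>\<theta> p. 4 / (3 * a) * sqrt (2 * \<beta> * p) * (sin \<theta>)\<^sup>2) \<theta> p T)) \<and>
          (\<forall>\<tau>\<in>T. sin (\<theta> \<tau>) \<noteq> 0 \<longrightarrow>
             constraint_eqs (H_dust \<kappa> a \<beta> \<alpha> :: 'l state \<Rightarrow> real) (\<theta> \<tau>) (p \<tau>)) \<and>
          (\<forall>\<tau>\<in>T. constraint_eqs_where_defined (H_dust \<kappa> a \<beta> \<alpha> :: 'l state \<Rightarrow> real) (\<theta> \<tau>) (p \<tau>))"
  proof (rule reduced_dynamics[OF assms(1,2,4)])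
    fix u q :: real assume uq: "sin u \<noteq> 0" "q > 0"
    have "((\<lambda>q. sqrt (2 * \<beta> * q)) has_real_derivative sqrt (2 * \<beta>) / (2 * sqrt q)) (at q)"
      using DERIV_cmult[OF DERIV_real_sqrt[OF uq(2)], of "sqrt (2 * \<beta>)"]
      by (simp add: real_sqrt_mult field_simps)
    from DERIV_cmult_right[OF DERIV_cmult[OF this, of "4 / (3 * a)"], of "(sin u)\<^sup>2"]
    show "((\<lambda>q. 4 / (3 * a) * sqrt (2 * \<beta> * q) * (sin u)\<^sup>2) has_real_derivative
        4 / (3 * a) * (sqrt (2 * \<beta>) / (2 * sqrt q)) * (sin u)\<^sup>2) (at q)" .
    have "((\<lambda>u. (sin u)\<^sup>2) has_real_derivative 2 * sin u * cos u) (at u)"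
      by (auto intro!: derivative_eq_intros)
    from DERIV_cmult[OF this, of "4 / (3 * a) * sqrt (2 * \<beta> * q)"]
    show "((\<lambda>u. 4 / (3 * a) * sqrt (2 * \<beta> * q) * (sin u)\<^sup>2) has_real_derivative
        4 / (3 * a) * sqrt (2 * \<beta> * q) * (2 * sin u * cos u)) (at u)" .
  qed (use assms edge in \<open>auto simp: H_dust_isotropic_zero H_dust_nonneg Dp Dt D0\<close>)
next
  define D where "D \<theta> r = a\<^sup>2 / \<kappa> * (sqrt (2 * \<kappa>) * \<beta> / 3) * sgn (sin \<theta>) * r" for \<theta> r
  have edge: "sin u \<noteq> 0 \<Longrightarrow> q > 0 \<Longrightarrow>
      (along_theta_par (H_scalar \<kappa> a \<beta>) u q (w :: 'l vertex, J) has_real_derivative D u (q * cos u)) (at 0)"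
    "sin u \<noteq> 0 \<Longrightarrow> q > 0 \<Longrightarrow>
      (along_p_par (H_scalar \<kappa> a \<beta>) u q (w, J) has_real_derivative D u (sin u)) (at 0)"
    "sin u \<noteq> 0 \<Longrightarrow> q > 0 \<Longrightarrow> b \<noteq> J \<Longrightarrow>
      (along_theta_perp (H_scalar \<kappa> a \<beta>) u q (w, J) b has_real_derivative D u 0) (at 0)"
    "sin u \<noteq> 0 \<Longrightarrow> q > 0 \<Longrightarrow> b \<noteq> J \<Longrightarrow>
      (along_p_perp (H_scalar \<kappa> a \<beta>) u q (w, J) b has_real_derivative D u 0) (at 0)"
    for u q w J b
    by (rule edge_derivative_cases[where D = "\<lambda>r y. D u r"];
        use scalar_edge_derivative[OF assms(1-3), folded D_def] in blast)+
  have D: "D u r = a\<^sup>2 / \<kappa> * (sqrt (2 * \<kappa>) * \<beta> / 3 * (sgn (sin u) * r))" for u r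
    by (simp add: D_def)
  show "(\<forall>\<tau>\<in>T. sin (\<theta> \<tau>) \<noteq> 0 \<longrightarrow>
            evolution_derivs_exist (H_scalar \<kappa> a \<beta> :: 'l state \<Rightarrow> real) (\<theta> \<tau>) (p \<tau>) \<and>
            hamilton_derivs_exist (\<lambda>\<theta> p. sqrt (2 * \<kappa>) * \<beta> * p / 3 * sqrt ((sin \<theta>)\<^sup>2)) (\<theta> \<tau>) (p \<tau>)) \<and>
         ((\<forall>\<tau>\<in>T. evolution_derivs_exist (H_scalar \<kappa> a \<beta> :: 'l state \<Rightarrow> real) (\<theta> \<tau>) (p \<tau>) \<and>
                 hamilton_derivs_exist (\<lambda>\<theta> p. sqrt (2 * \<kappa>) * \<beta> * p / 3 * sqrt ((sin \<theta>)\<^sup>2)) (\<theta> \<tau>) (p \<tau>)) \<longrightarrow>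
            (evolution_eqs \<kappa> a (H_scalar \<kappa> a \<beta> :: 'l state \<Rightarrow> real) \<theta> p T \<longleftrightarrow>
             hamilton_eqs (\<lambda>\<theta> p. sqrt (2 * \<kappa>) * \<beta> * p / 3 * sqrt ((sin \<theta>)\<^sup>2)) \<theta> p T)) \<and>
         (\<forall>\<tau>\<in>T. sin (\<theta> \<tau>) \<noteq> 0 \<longrightarrow>
            constraint_eqs (H_scalar \<kappa> a \<beta> :: 'l state \<Rightarrow> real) (\<theta> \<tau>) (p \<tau>)) \<and>
         (\<forall>\<tau>\<in>T. constraint_eqs_where_defined (H_scalar \<kappa> a \<beta> :: 'l state \<Rightarrow> real) (\<theta> \<tau>) (p \<tau>))"
  proof (rule reduced_dynamics[OF assms(1,2,4)])
    fix u q :: real assume uq: "sin u \<noteq> 0" "q > 0"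
    show "((\<lambda>q. sqrt (2 * \<kappa>) * \<beta> * q / 3 * sqrt ((sin u)\<^sup>2)) has_real_derivative
        sqrt (2 * \<kappa>) * \<beta> / 3 * (sgn (sin u) * sin u)) (at q)"
      by (auto intro!: derivative_eq_intros simp: sgn_if abs_if)
    \<comment> \<open>The square root of the squared sine is its absolute value, differentiable
      where the sine is nonzero; its sign matches the \<open>sgn\<close> in the edge
      derivative.\<close>
    have "((\<lambda>u. sqrt \<bar>(sin u)\<^sup>2\<bar>) has_real_derivative 2 * sin u * cos u / (2 * sqrt ((sin u)\<^sup>2))) (at u)"
      using uq by (intro DERIV_sqrt_abs) (auto intro!: derivative_eq_intros)
    then have "((\<lambda>u. sqrt ((sin u)\<^sup>2)) has_real_derivative sgn (sin u) * cos u) (at u)"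
      using uq by (simp add: sgn_if abs_if split: if_splits)
    from DERIV_cmult[OF this, of "sqrt (2 * \<kappa>) * \<beta> * q / 3"]
    show "((\<lambda>u. sqrt (2 * \<kappa>) * \<beta> * q / 3 * sqrt ((sin u)\<^sup>2)) has_real_derivative
        sqrt (2 * \<kappa>) * \<beta> / 3 * (sgn (sin u) * (q * cos u))) (at u)"
      by (simp add: mult_ac)
  next
    fix u q :: real and w :: "'l vertex" and J b assume uq: "sin u \<noteq> 0" "q > 0"
    show "(along_p_par (H_scalar \<kappa> a \<beta>) u q (w, J) has_real_derivative
        a\<^sup>2 / \<kappa> * (sqrt (2 * \<kappa>) * \<beta> / 3 * (sgn (sin u) * sin u))) (at 0)"
      "(along_theta_par (H_scalar \<kappa> a \<beta>) u q (w, J) has_real_derivative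
        a\<^sup>2 / \<kappa> * (sqrt (2 * \<kappa>) * \<beta> / 3 * (sgn (sin u) * (q * cos u)))) (at 0)"
      unfolding D[symmetric] using edge uq by blast+
  next
    fix u q :: real and w :: "'l vertex" and J b assume "sin u \<noteq> 0" "q > 0" and b: "b \<noteq> (J :: 3)"
    then show "(along_p_perp (H_scalar \<kappa> a \<beta>) u q (w, J) b has_real_derivative 0) (at 0)"
      "(along_theta_perp (H_scalar \<kappa> a \<beta>) u q (w, J) b has_real_derivative 0) (at 0)"
      using edge(3,4)[of u q b J w] by (simp_all add: D_def)
  qed (use assms in \<open>auto simp: H_scalar_isotropic_zero H_scalar_nonneg\<close>)
qed

end
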